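(* Let $\{A_i\}_{i\in I}$ be a finite family of invertible non-negative $2\times2$ matrices, and let $f_i=[F(A_i)]$ be the projective Möbius map for each $i\in I$. Then the following are equivalent. (1) $\{A_i\}_{i\in I}$ has no generalized heteroclinic connections of depth $2$. (2) $\{f_i\}_{i\in I}$ admits a common strictly invariant arc. (3) There is $P\in\mathrm{GL}_2(\mathbb R)$ such that $M_i=PA_iP^{-1}$ is a positive matrix for every $i\in I$.
   Context: A matrix is positive (resp. non-negative) if all its entries are $>0$ (resp. $\ge0$). $\mathrm{PGL}_2(\mathbb R)=\mathrm{GL}_2(\mathbb R)/\sim$, where $A\sim B$ iff $A=tB$ for some $t\in\mathbb R\setminus\{0\}$. The class $[M]$ of $M=\begin{pmatrix}\alpha&\beta\\ \gamma&\delta\end{pmatrix}$ is identified with the Möbius transformation $x\mapsto\frac{\alpha x+\beta}{\gamma x+\delta}$, acting on $\widehat{\mathbb R}=\mathbb R\cup\{\widehat\infty\}$. Define $F:\mathrm{GL}_2(\mathbb R)\to\mathrm{GL}_2(\mathbb R)$ by $$F\begin{pmatrix}p&q\\ r&s\end{pmatrix}=\frac12\begin{pmatrix}p-q-r+s&p+q-r-s\\ p-q+r-s&p+q+r+s\end{pmatrix}.$$ If $f(\widehat\infty)=\widehat\infty$, set $f'(\widehat\infty):=\frac{d}{dz}\frac1{f(1/z)}\big|_{z=0}$. A closed arc is a connected compact subset of $\widehat{\mathbb R}$ homeomorphic to $[0,1]$ (in particular it is nonempty, not a single point, and not all of $\widehat{\mathbb R}$). A finite family of Möbius transformations $\{f_i\}_{i\in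 I}$ admits a common strictly invariant arc if there is a closed arc $J$ with $f_i(J)\subset\mathring J$ for all $i\in I$, where $\mathring J$ is the interior of $J$ in $\widehat{\mathbb R}$. Generalized heteroclinic connections: for $k\in\mathbb N\cup\{\infty\}$ let $$\mathcal F_k=\bigcup_{n=1}^{k}\{f_{i_n}\circ\cdots\circ f_{i_1}\mid(i_1,\dots,i_n)\in I^n\}$$ (the union over all $n\in\mathbb N$ if $k=\infty$), $$\mathrm{Attr}_k=\{a\in\widehat{\mathbb R}\mid\text{there is }f\in\mathcal F_k\text{ with }f(a)=a,\ |f'(a)|\le1\},$$ $$\mathrm{Rep}_k=\{b\in\widehat{\mathbb R}\mid\text{there is }f\in\mathcal F_k\text{ with }f(b)=b,\ |f'(b)|\ge1\}.$$ $\{A_i\}_{i\in I}$ has a generalized heteroclinic connection of depth $k$ if there are $h\in\{\mathrm{id}\}\cup\mathcal F_k$ and $a\in\mathrm{Attr}_k$ such that $h(a)\in\mathrm{Rep}_k$. *)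

theory Defs
  imports "HOL-Analysis.Analysis" "HOL-Library.Extended_Nat"
begin

definition nonneg_mat :: "real^2^2 \<Rightarrow> bool" where
  "nonneg_mat M \<longleftrightarrow> (\<forall>i j. 0 \<le> M $ i $ j)"

definition pos_mat :: "real^2^2 \<Rightarrow> bool" where
  "pos_mat M \<longleftrightarrow> (\<forall>i j. 0 < M $ i $ j)"

text \<open>The projective line is the one-point compactification of the real line;
  \<^term>\<open>None\<close> is the point at infinity.\<close>

type_synonym rhat = "real option"

abbreviation rhat_top :: "rhat topology" where
  "rhat_top \<equiv> Alexandroff_compactification euclideanreal"

text \<open>The class of an invertible matrix \<open>M\<close> in PGL(2) is represented by the map it induces on
  the projective line. For invertible \<open>M\<close> the numerators below are nonzero whenever the
  denominators vanish.\<close>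

definition mobius :: "real^2^2 \<Rightarrow> rhat \<Rightarrow> rhat" where
  "mobius M p = (case p of
      None \<Rightarrow> (if M$2$1 = 0 then None else Some (M$1$1 / M$2$1))
    | Some x \<Rightarrow> (if M$2$1 * x + M$2$2 = 0 then None
                 else Some ((M$1$1 * x + M$1$2) / (M$2$1 * x + M$2$2))))"

definition Fmat :: "real^2^2 \<Rightarrow> real^2^2" where
  "Fmat M = (let p = M$1$1; q = M$1$2; r = M$2$1; s = M$2$2 in
     (1/2) *\<^sub>R vector [vector [p - q - r + s, p + q - r - s],
                      vector [p - q + r - s, p + q + r + s]])"

definition rhat_inverse :: "rhat \<Rightarrow> rhat" where
  "rhat_inverse p = (case p of
      None \<Rightarrow> Some 0
    | Some x \<Rightarrow> (if x = 0 then None else Some (1 / x)))"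

text \<open>A real-valued version of a self-map of the projective line. The value 0 chosen where the
  map is infinite is irrelevant for the derivatives below: they are only used at fixed points
  of Moebius maps, near which the relevant map is finite.\<close>

definition real_part_map :: "(rhat \<Rightarrow> rhat) \<Rightarrow> real \<Rightarrow> real" where
  "real_part_map f x = (case f (Some x) of None \<Rightarrow> 0 | Some y \<Rightarrow> y)"

text \<open>Derivative at a fixed point \<open>p\<close> of \<open>f\<close>; at infinity it is the derivative of
  \<open>z \<mapsto> 1 / f (1/z)\<close> at 0, with the conventions \<open>1/0 = \<infinity>\<close> and \<open>1/\<infinity> = 0\<close>.\<close>

definition deriv_fix :: "(rhat \<Rightarrow> rhat) \<Rightarrow> rhat \<Rightarrow> real" where
  "deriv_fix f p = (case p of
      Some x \<Rightarrow> deriv (real_part_map f) x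
    | None \<Rightarrow> deriv (real_part_map (rhat_inverse \<circ> f \<circ> rhat_inverse)) 0)"

definition closed_arc :: "rhat set \<Rightarrow> bool" where
  "closed_arc J \<longleftrightarrow> connectedin rhat_top J \<and> compactin rhat_top J \<and>
     subtopology rhat_top J homeomorphic_space top_of_set {0..1::real}"

definition common_strictly_invariant_arc :: "'i set \<Rightarrow> ('i \<Rightarrow> rhat \<Rightarrow> rhat) \<Rightarrow> bool" where
  "common_strictly_invariant_arc I f \<longleftrightarrow>
     (\<exists>J. closed_arc J \<and> (\<forall>i\<in>I. f i ` J \<subseteq> rhat_top interior_of J))"

text \<open>For a word \<open>is = [i\<^sub>1, \<dots>, i\<^sub>n]\<close>, \<^term>\<open>fold f is\<close> is the composition
  \<open>f i\<^sub>n \<circ> \<dots> \<circ> f i\<^sub>1\<close>.\<close>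

definition compositions :: "enat \<Rightarrow> 'i set \<Rightarrow> ('i \<Rightarrow> rhat \<Rightarrow> rhat) \<Rightarrow> (rhat \<Rightarrow> rhat) set" where
  "compositions k I f = {fold f is | is. is \<in> lists I \<and> 1 \<le> length is \<and> enat (length is) \<le> k}"

definition Attr :: "enat \<Rightarrow> 'i set \<Rightarrow> ('i \<Rightarrow> rhat \<Rightarrow> rhat) \<Rightarrow> rhat set" where
  "Attr k I f = {a. \<exists>g \<in> compositions k I f. g a = a \<and> \<bar>deriv_fix g a\<bar> \<le> 1}"

definition Rep :: "enat \<Rightarrow> 'i set \<Rightarrow> ('i \<Rightarrow> rhat \<Rightarrow> rhat) \<Rightarrow> rhat set" where
  "Rep k I f = {b. \<exists>g \<in> compositions k I f. g b = b \<and> \<bar>deriv_fix g b\<bar> \<ge> 1}"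

definition gen_heteroclinic_connection :: "enat \<Rightarrow> 'i set \<Rightarrow> ('i \<Rightarrow> real^2^2) \<Rightarrow> bool" where
  "gen_heteroclinic_connection k I A \<longleftrightarrow> (let f = (\<lambda>i. mobius (Fmat (A i))) in
     (\<exists>h \<in> {id} \<union> compositions k I f. \<exists>a \<in> Attr k I f. h a \<in> Rep k I f))"

end

theory Submission
  imports Defs
begin

text \<open>
  Conjugating by the rotation behind \<^const>\<open>Fmat\<close> turns the statement into linear algebra on
  the closed first quadrant \<open>K\<close>, which every \<open>A i\<close> maps into itself: fixed points are
  eigenvectors, the multiplier at an eigenvector with eigenvalue \<open>l\<close> is \<open>det / l\<^sup>2\<close>, closed arcs
  are the images of \<open>K\<close> under invertible matrices, and strict invariance of an arc says that the
  conjugated matrix is positive up to a sign, which the trace determines.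

  A connection is impossible for positive matrices, because attracting eigenvectors
  lie in the open quadrant, repelling ones outside the closed quadrant, and the open quadrant is
  preserved. Conversely, if there is no connection of depth 2, a strictly invariant cone is found by
  perturbing \<open>K\<close> at its two edges: shrink \<open>K\<close> at an edge that repels and enlarge it
  at an edge that attracts. A matrix that maps one edge to the other couples the
  two perturbations, and two such matrices of opposite directions compose to a word of length 2
  that fixes an edge; the resulting linear inequalities are solvable because no attracting
  edge is repelling or is mapped to a repelling one.
\<close>

section \<open>Moebius maps in homogeneous coordinates\<close>

text \<open>The point with homogeneous coordinates \<open>v\<close>. The zero vector represents no
  point and receives the default value \<open>None\<close>, which is why \<open>v \<noteq> 0\<close>
  accompanies most later facts.\<close>

definition proj :: "real^2 \<Rightarrow> rhat" where
  "proj v = (if v$2 = 0 then None else Some (v$1 / v$2))"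

lemma mult_vec_2:
  fixes M :: "real^2^2"
  shows "(M *v v) $ 1 = M$1$1 * v$1 + M$1$2 * v$2"
    and "(M *v v) $ 2 = M$2$1 * v$1 + M$2$2 * v$2"
  by (simp_all add: matrix_vector_mult_def sum_2)

lemma mult_mat_2:
  fixes M N :: "real^2^2"
  shows "(M ** N) $ i $ j = M$i$1 * N$1$j + M$i$2 * N$2$j"
  by (simp add: matrix_matrix_mult_def sum_2)

lemma vec_2_eq_iff: "(u::'a^2) = v \<longleftrightarrow> u$1 = v$1 \<and> u$2 = v$2"
  by (simp add: vec_eq_iff forall_2)

lemma mobius_proj: "v \<noteq> 0 \<Longrightarrow> mobius M (proj v) = proj (M *v v)"
proof (cases "v$2 = 0")
  case True
  assume "v \<noteq> 0"
  then show ?thesis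
    using True by (auto simp: mobius_def proj_def mult_vec_2 vec_2_eq_iff)
next
  case False
  then have "a * (v$1 / v$2) + b = (a * v$1 + b * v$2) / v$2" for a b
    by (simp add: field_simps)
  then show ?thesis
    using False by (auto simp: mobius_def proj_def mult_vec_2)
qed

lemma proj_cases: obtains v where "v \<noteq> 0" "p = proj v"
proof (cases p)
  case None
  show ?thesis
    by (rule that[of "vector [1, 0]"]) (simp_all add: None proj_def vec_2_eq_iff)
next
  case (Some x)
  show ?thesis
    by (rule that[of "vector [x, 1]"]) (simp_all add: Some proj_def vec_2_eq_iff)
qed

lemma proj_scale: "c \<noteq> 0 \<Longrightarrow> proj (c *\<^sub>R v) = proj v"
  by (simp add: proj_def)

lemma proj_eqD:
  assumes "proj u = proj v" "v \<noteq> 0"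
  obtains c where "u = c *\<^sub>R v"
proof (cases "v$2 = 0")
  case True
  then show ?thesis
    using assms by (intro that[of "u$1 / v$1"]) (auto simp: proj_def vec_2_eq_iff split: if_splits)
next
  case False
  then show ?thesis
    using assms by (intro that[of "u$2 / v$2"]) (auto simp: proj_def vec_2_eq_iff field_simps split: if_splits)
qed

lemma mult_vec_nonzero: "invertible (M::real^2^2) \<Longrightarrow> v \<noteq> 0 \<Longrightarrow> M *v v \<noteq> 0"
  by (metis invertible_def matrix_vector_mul_assoc matrix_vector_mul_lid matrix_vector_mult_0_right)

text \<open>Apply \<open>mobius_proj\<close> twice to a nonzero representative; invertibility of
  \<open>N\<close> keeps \<open>N *v v\<close> nonzero for the second application.\<close>

lemma mobius_mult:
  assumes "invertible N"
  shows "mobius (M ** N) = mobius M \<circ> mobius N"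
proof
  fix p
  obtain v where "v \<noteq> 0" "p = proj v" by (rule proj_cases)
  then show "mobius (M ** N) p = (mobius M \<circ> mobius N) p"
    using assms by (simp add: mobius_proj mult_vec_nonzero matrix_vector_mul_assoc)
qed

lemma mobius_mat_1: "mobius (mat 1) = id"
  by (rule ext) (auto simp: mobius_def mat_def split: option.splits)

section \<open>Multipliers at fixed points\<close>

lemma rhat_inverse_eq_mobius: "rhat_inverse = mobius (vector [vector [0, 1], vector [1, 0]])"
  by (rule ext) (auto simp: mobius_def rhat_inverse_def split: option.splits)

lemma deriv_real_part_mobius:
  assumes "M$2$1 * x + M$2$2 = l" "l \<noteq> 0"
  shows "deriv (real_part_map (mobius M)) x = det M / l\<^sup>2"
proof (rule DERIV_imp_deriv)
  have "((\<lambda>y. (M$1$1 * y + M$1$2) / (M$2$1 * y + M$2$2)) has_real_derivative det M / l\<^sup>2) (at x)"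
    using assms
    by (auto intro!: derivative_eq_intros simp: det_2 power2_eq_square) (simp add: algebra_simps)
  moreover have "open {y. M$2$1 * y + M$2$2 \<noteq> 0}"
    by (intro open_Collect_neq continuous_intros)
  \<comment> \<open>At a pole \<open>real_part_map\<close> takes a default value, so it is compared
    with the quotient only near \<open>x\<close>, where the denominator stays nonzero.\<close>
  then have "\<forall>\<^sub>F y in nhds x. M$2$1 * y + M$2$2 \<noteq> 0"
    using assms eventually_nhds_in_open[of "{y. M$2$1 * y + M$2$2 \<noteq> 0}" x] by simp
  then have "\<forall>\<^sub>F y in nhds x. (M$1$1 * y + M$1$2) / (M$2$1 * y + M$2$2) = real_part_map (mobius M) y"
    by eventually_elim (simp add: real_part_map_def mobius_def)
  ultimately show "(real_part_map (mobius M) has_real_derivative det M / l\<^sup>2) (at x)"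
    by (subst (asm) DERIV_cong_ev[OF refl _ refl])
qed

text \<open>The tangent line at the point of \<open>v\<close> is
  \<open>Hom(span v, R^2 / span v)\<close>. The matrix acts by \<open>l\<close> on
  \<open>span v\<close> and by \<open>det M / l\<close> on the quotient, hence by
  \<open>det M / l^2\<close> on the tangent line. In coordinates, the denominator at the fixed point
  is exactly \<open>l\<close>.\<close>

lemma deriv_fix_eigenvector:
  assumes "invertible M" "v \<noteq> 0" "M *v v = l *\<^sub>R v"
  shows "deriv_fix (mobius M) (proj v) = det M / l\<^sup>2"
proof -
  have "l \<noteq> 0"
    using mult_vec_nonzero[OF assms(1,2)] assms(3) by auto
  have eig: "M$1$1 * v$1 + M$1$2 * v$2 = l * v$1" "M$2$1 * v$1 + M$2$2 * v$2 = l * v$2"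
    using assms(3) by (simp_all add: vec_2_eq_iff mult_vec_2)
  show ?thesis
  proof (cases "v$2 = 0")
    case True
    \<comment> \<open>The coordinate swap represents \<open>rhat_inverse\<close>, so the derivative
      at infinity is that of the conjugate by \<open>J\<close> at 0, where the denominator is
      \<open>M$1$1 = l\<close>.\<close>
    define J :: "real^2^2" where "J = vector [vector [0, 1], vector [1, 0]]"
    have J: "invertible J" by (simp add: invertible_det_nz J_def det_2)
    have "rhat_inverse \<circ> mobius M \<circ> rhat_inverse = mobius (J ** M ** J)"
      using assms(1) J by (simp add: rhat_inverse_eq_mobius mobius_mult J_def[symmetric] invertible_mult o_assoc)
    moreover have "deriv (real_part_map (mobius (J ** M ** J))) 0 = det (J ** M ** J) / l\<^sup>2"
      using True eig assms(2) \<open>l \<noteq> 0\<close>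
      by (intro deriv_real_part_mobius) (auto simp: mult_mat_2 J_def vec_2_eq_iff)
    moreover have "det (J ** M ** J) = det M"
      by (simp add: det_mul J_def) (simp add: det_2)
    ultimately show ?thesis
      using True by (simp add: deriv_fix_def proj_def)
  next
    case False
    then show ?thesis
      using eig \<open>l \<noteq> 0\<close> deriv_real_part_mobius[of M "v$1/v$2" l]
      by (auto simp: deriv_fix_def proj_def field_simps)
  qed
qed

text \<open>Up to a positive scalar this is the rotation that conjugates \<^term>\<open>M\<close> to
  \<^term>\<open>Fmat M\<close>.\<close>

definition cay :: "real^2 \<Rightarrow> real^2" where
  "cay v = vector [v$1 - v$2, v$1 + v$2]"

lemma cay_simps: "cay v = 0 \<longleftrightarrow> v = 0" "cay (c *\<^sub>R v) = c *\<^sub>R cay v" "cay u = cay v \<longleftrightarrow> u = v"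
  by (auto simp: cay_def vec_2_eq_iff algebra_simps)

lemma cay_surj: obtains v where "u = cay v"
  by (rule that[of "vector [(u$1 + u$2) / 2, (u$2 - u$1) / 2]"])
     (simp add: cay_def vec_2_eq_iff field_simps)

lemma Fmat_mult_cay: "Fmat M *v cay v = cay (M *v v)"
  by (simp add: Fmat_def cay_def vec_2_eq_iff mult_vec_2 Let_def field_simps)

lemma det_Fmat: "det (Fmat M) = det M"
  by (simp add: Fmat_def Let_def det_2 field_simps)

lemma invertible_Fmat: "invertible (Fmat M) \<longleftrightarrow> invertible M"
  by (simp add: invertible_det_nz det_Fmat)

lemma Fmat_mult: "Fmat (M ** N) = Fmat M ** Fmat N"
  by (simp add: Fmat_def Let_def vec_2_eq_iff mult_mat_2 field_simps)

lemma Fmat_mat_1: "Fmat (mat 1) = mat 1"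
  by (simp add: Fmat_def Let_def vec_2_eq_iff mat_def)

text \<open>\<open>Fmat\<close> is conjugation by a rotation, and the witness is the inverse
  conjugation. This allows every chart of an arc to be written as
  \<open>mobius (Fmat Q)\<close>.\<close>

lemma Fmat_surj: obtains N where "M = Fmat N"
proof
  show "M = Fmat ((1/2) *\<^sub>R vector
      [vector [M$1$1 + M$2$1 + M$1$2 + M$2$2, M$1$2 + M$2$2 - M$1$1 - M$2$1],
       vector [M$2$1 - M$1$1 + M$2$2 - M$1$2, M$1$1 - M$2$1 - M$1$2 + M$2$2]])"
    by (simp add: Fmat_def Let_def vec_2_eq_iff field_simps)
qed

section \<open>Words in the matrices, and connections as eigenvector conditions\<close>

definition word :: "('i \<Rightarrow> real^2^2) \<Rightarrow> 'i list \<Rightarrow> real^2^2" where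
  "word A is = fold (\<lambda>i M. A i ** M) is (mat 1)"

lemma word_simps:
  "word A [] = mat 1" "word A [i] = A i" "word A [i, j] = A j ** A i" "word A (is @ [i]) = A i ** word A is"
  by (simp_all add: word_def)

text \<open>Appending a letter multiplies on the left, in agreement with \<open>fold\<close>, so
  induction from the end of the word produces the products \<open>A i ** M\<close>.\<close>

lemma word_rev_induct:
  assumes "is \<in> lists I" "Q (mat 1)" "\<And>i M. i \<in> I \<Longrightarrow> Q M \<Longrightarrow> Q (A i ** M)"
  shows "Q (word A is)"
  using assms(1) by (induction "is" rule: rev_induct) (auto simp: word_simps assms(2,3))

lemma invertible_word:
  assumes "\<forall>i\<in>I. invertible (A i)" "is \<in> lists I"
  shows "invertible (word A is)"
  using assms by (intro word_rev_induct[of "is" I invertible]) (auto simp: invertible_det_nz det_mul)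

lemma fold_mobius:
  assumes "\<forall>i\<in>I. invertible (A i)" "is \<in> lists I"
  shows "fold (\<lambda>i. mobius (Fmat (A i))) is = mobius (Fmat (word A is))"
  using assms(2)
proof (induction "is" rule: rev_induct)
  case Nil
  show ?case by (simp add: word_simps Fmat_mat_1 mobius_mat_1)
next
  case (snoc i "is")
  then show ?case
    by (simp add: word_simps Fmat_mult mobius_mult invertible_Fmat invertible_word[OF assms(1)])
qed

lemma compositions_mobius:
  assumes "\<forall>i\<in>I. invertible (A i)"
  shows "compositions k I (\<lambda>i. mobius (Fmat (A i))) =
    {mobius (Fmat (word A is)) | is. is \<in> lists I \<and> 1 \<le> length is \<and> enat (length is) \<le> k}"
proof -
  have *: "fold (\<lambda>i. mobius (Fmat (A i))) is = mobius (Fmat (word A is))" if "is \<in> lists I" for "is"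
    using assms that by (rule fold_mobius)
  then show ?thesis
    unfolding compositions_def by (intro Collect_cong ex_cong1) (metis *)
qed

text \<open>Proportionality of \<open>cay (M *v v)\<close> and \<open>cay v\<close> is pulled back
  along the injective linear map \<open>cay\<close>. The predicate \<open>R\<close> stands for the
  bound on the multiplier, attracting or repelling.\<close>

lemma fixed_point_iff_eigenvector:
  assumes "v \<noteq> 0" "invertible M"
  shows "mobius (Fmat M) (proj (cay v)) = proj (cay v) \<and> R (deriv_fix (mobius (Fmat M)) (proj (cay v)))
    \<longleftrightarrow> (\<exists>l. M *v v = l *\<^sub>R v \<and> R (det M / l\<^sup>2))"
proof -
  have "mobius (Fmat M) (proj (cay v)) = proj (cay v) \<longleftrightarrow> (\<exists>l. M *v v = l *\<^sub>R v)"
    (is "?L \<longleftrightarrow> ?R")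
  proof
    assume ?L
    then have "proj (cay (M *v v)) = proj (cay v)"
      using assms(1) by (simp add: mobius_proj cay_simps Fmat_mult_cay)
    then obtain c where "cay (M *v v) = c *\<^sub>R cay v"
      using assms(1) proj_eqD cay_simps(1) by metis
    then show ?R
      by (metis cay_simps(2,3))
  next
    assume ?R
    then obtain l where l: "M *v v = l *\<^sub>R v" by blast
    then have "l \<noteq> 0" using mult_vec_nonzero[OF assms(2,1)] by auto
    then show ?L
      using assms(1) l by (simp add: mobius_proj cay_simps Fmat_mult_cay proj_scale)
  qed
  moreover have "deriv_fix (mobius (Fmat M)) (proj (cay v)) = det M / l\<^sup>2" if "M *v v = l *\<^sub>R v" for l
    using that assms deriv_fix_eigenvector[of "Fmat M" "cay v" l]
    by (simp add: invertible_Fmat cay_simps Fmat_mult_cay det_Fmat)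
  ultimately show ?thesis by metis
qed

text \<open>Every point is \<open>proj (cay v)\<close> for some nonzero \<open>v\<close>, and
  clearing \<open>l^2\<close> from the multiplier \<open>det / l^2\<close> gives the stated
  inequalities. The empty word \<open>hs\<close> accounts for \<open>h = id\<close>.\<close>

lemma gen_heteroclinic_connection_iff:
  assumes "\<forall>i\<in>I. invertible (A i)"
  shows "gen_heteroclinic_connection k I A \<longleftrightarrow>
    (\<exists>us hs ws v l m. us \<in> lists I \<and> hs \<in> lists I \<and> ws \<in> lists I \<and> 1 \<le> length us \<and> 1 \<le> length ws \<and>
      enat (length us) \<le> k \<and> enat (length hs) \<le> k \<and> enat (length ws) \<le> k \<and> v \<noteq> 0 \<and>
      word A us *v v = l *\<^sub>R v \<and> \<bar>det (word A us)\<bar> \<le> l\<^sup>2 \<and>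
      word A ws *v (word A hs *v v) = m *\<^sub>R (word A hs *v v) \<and> m\<^sup>2 \<le> \<bar>det (word A ws)\<bar>)"
    (is "?L \<longleftrightarrow> ?R")
proof -
  note inv = invertible_word[OF assms]
  have nz: "l \<noteq> 0" if "is \<in> lists I" "v \<noteq> 0" "word A is *v v = l *\<^sub>R v" for "is" v l
    using mult_vec_nonzero[OF inv] that by fastforce
  define f where "f = (\<lambda>i. mobius (Fmat (A i)))"
  have comp: "g \<in> compositions k I f \<longleftrightarrow>
      (\<exists>is. g = mobius (Fmat (word A is)) \<and> is \<in> lists I \<and> 1 \<le> length is \<and> enat (length is) \<le> k)" for g
    unfolding compositions_mobius[OF assms, folded f_def] by blast
  have "is = [] \<or> 1 \<le> length is" for "is" :: "'a list"
    by (cases "is") auto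
  moreover have "mobius (Fmat (word A [])) = id"
    by (simp add: word_simps Fmat_mat_1 mobius_mat_1)
  moreover have "[] \<in> lists I" "enat (length []) \<le> k"
    by (simp_all flip: zero_enat_def)
  ultimately have idc: "h \<in> {id} \<union> compositions k I f \<longleftrightarrow>
      (\<exists>hs. h = mobius (Fmat (word A hs)) \<and> hs \<in> lists I \<and> enat (length hs) \<le> k)" for h
    unfolding Un_iff singleton_iff comp by metis
  have attr: "proj (cay v) \<in> Attr k I f \<longleftrightarrow> (\<exists>us l. us \<in> lists I \<and> 1 \<le> length us \<and> enat (length us) \<le> k
      \<and> word A us *v v = l *\<^sub>R v \<and> \<bar>det (word A us)\<bar> \<le> l\<^sup>2)" (is "_ = ?S") if "v \<noteq> 0" for v
  proof -
    have "proj (cay v) \<in> Attr k I f \<longleftrightarrow> (\<exists>us l. us \<in> lists I \<and> 1 \<le> length us \<and> enat (length us) \<le> k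
      \<and> word A us *v v = l *\<^sub>R v \<and> \<bar>det (word A us) / l\<^sup>2\<bar> \<le> 1)"
      using fixed_point_iff_eigenvector[OF that inv, where R = "\<lambda>x. \<bar>x\<bar> \<le> 1"]
      unfolding Attr_def mem_Collect_eq Bex_def comp by blast
    also have "\<dots> \<longleftrightarrow> ?S"
      by (intro ex_cong1 conj_cong refl) (simp add: abs_divide divide_simps nz[OF _ that])
    finally show ?thesis .
  qed
  have rep: "proj (cay v) \<in> Rep k I f \<longleftrightarrow> (\<exists>us l. us \<in> lists I \<and> 1 \<le> length us \<and> enat (length us) \<le> k
      \<and> word A us *v v = l *\<^sub>R v \<and> l\<^sup>2 \<le> \<bar>det (word A us)\<bar>)" (is "_ = ?S") if "v \<noteq> 0" for v
  proof -
    have "proj (cay v) \<in> Rep k I f \<longleftrightarrow> (\<exists>us l. us \<in> lists I \<and> 1 \<le> length us \<and> enat (length us) \<le> k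
      \<and> word A us *v v = l *\<^sub>R v \<and> \<bar>det (word A us) / l\<^sup>2\<bar> \<ge> 1)"
      using fixed_point_iff_eigenvector[OF that inv, where R = "\<lambda>x. \<bar>x\<bar> \<ge> 1"]
      unfolding Rep_def mem_Collect_eq Bex_def comp by blast
    also have "\<dots> \<longleftrightarrow> ?S"
      by (intro ex_cong1 conj_cong refl) (simp add: abs_divide divide_simps nz[OF _ that])
    finally show ?thesis .
  qed
  have "?L \<longleftrightarrow> (\<exists>hs v. hs \<in> lists I \<and> enat (length hs) \<le> k \<and> v \<noteq> 0 \<and> proj (cay v) \<in> Attr k I f \<and>
      mobius (Fmat (word A hs)) (proj (cay v)) \<in> Rep k I f)" (is "_ \<longleftrightarrow> ?M")
  proof
    assume ?L
    then obtain h a where ha: "h \<in> {id} \<union> compositions k I f" "a \<in> Attr k I f" "h a \<in> Rep k I f"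
      unfolding gen_heteroclinic_connection_def f_def Let_def by blast
    obtain u where u: "u \<noteq> 0" "a = proj u" by (rule proj_cases)
    obtain v where "u = cay v" by (rule cay_surj)
    then show ?M using ha u idc by (auto simp: cay_simps)
  next
    assume ?M
    then show ?L
      unfolding gen_heteroclinic_connection_def f_def[symmetric] Let_def using idc by blast
  qed
  also have "\<dots> \<longleftrightarrow> (\<exists>hs v. hs \<in> lists I \<and> enat (length hs) \<le> k \<and> v \<noteq> 0 \<and> proj (cay v) \<in> Attr k I f \<and>
      proj (cay (word A hs *v v)) \<in> Rep k I f)"
    by (intro ex_cong1) (auto simp: mobius_proj cay_simps Fmat_mult_cay)
  also have "\<dots> \<longleftrightarrow> (\<exists>hs v. hs \<in> lists I \<and> enat (length hs) \<le> k \<and> v \<noteq> 0 \<and>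
      (\<exists>us l. us \<in> lists I \<and> 1 \<le> length us \<and> enat (length us) \<le> k
      \<and> word A us *v v = l *\<^sub>R v \<and> \<bar>det (word A us)\<bar> \<le> l\<^sup>2) \<and>
      (\<exists>us l. us \<in> lists I \<and> 1 \<le> length us \<and> enat (length us) \<le> k
      \<and> word A us *v (word A hs *v v) = l *\<^sub>R (word A hs *v v) \<and> l\<^sup>2 \<le> \<bar>det (word A us)\<bar>))"
    using attr rep mult_vec_nonzero[OF inv] by (intro ex_cong1) blast
  also have "\<dots> \<longleftrightarrow> ?R" by blast
  finally show ?thesis .
qed

section \<open>Perturbing the first quadrant\<close>

text \<open>Any number between the maximum of \<open>S\<close> and the minimum of \<open>T\<close>
  serves. Inserting \<open>0\<close> into \<open>S\<close> and \<open>m + 1\<close> into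
  \<open>T\<close> makes both extrema exist for empty sets and the result positive.\<close>

lemma ex_separating_positive_real:
  fixes S T :: "real set"
  assumes "finite S" "finite T" "\<And>t. t \<in> T \<Longrightarrow> 0 < t" "\<And>s t. s \<in> S \<Longrightarrow> t \<in> T \<Longrightarrow> s < t"
  shows "\<exists>k>0. (\<forall>s\<in>S. s < k) \<and> (\<forall>t\<in>T. k < t)"
proof -
  define m where "m = Max (insert 0 S)"
  have m: "0 \<le> m" "\<And>s. s \<in> S \<Longrightarrow> s \<le> m"
    using assms(1) by (auto simp: m_def)
  have "m \<in> insert 0 S"
    unfolding m_def using assms(1) by (intro Max_in) auto
  then have mT: "\<And>t. t \<in> T \<Longrightarrow> m < t"
    using assms(3,4) by auto
  have "m < Min (insert (m + 1) T)"
    using mT assms(2) by simp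
  then obtain k where "m < k" "k < Min (insert (m + 1) T)"
    using dense by blast
  with m assms(2) show ?thesis
    by (intro exI[of _ k]) force
qed

section \<open>Inverse matrices and signs for small parameters\<close>

lemma matrix_inv_mult:
  fixes P :: "'a::semiring_1^'n^'n"
  assumes "invertible P"
  shows "P ** matrix_inv P = mat 1" "matrix_inv P ** P = mat 1"
  using someI_ex[OF assms[unfolded invertible_def]] unfolding matrix_inv_def by auto

lemma matrix_inv_eqI:
  fixes P Q :: "'a::semiring_1^'n^'n"
  assumes "P ** Q = mat 1" "Q ** P = mat 1"
  shows "matrix_inv P = Q"
proof -
  have "invertible P" using assms by (auto simp: invertible_def)
  from matrix_inv_mult[OF this] show ?thesis
    by (metis assms(2) matrix_mul_assoc matrix_mul_lid matrix_mul_rid)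
qed

text \<open>By continuity a positive \<open>c0\<close> decides the sign; if \<open>c0 = 0\<close>,
  then \<open>c1\<close> decides it after a factor \<open>t > 0\<close> is split off.\<close>

lemma eventually_pos_quadratic:
  fixes c0 :: real
  assumes "0 \<le> c0" "c0 = 0 \<Longrightarrow> 0 < c1"
  shows "\<forall>\<^sub>F t in at_right 0. 0 < c0 + c1 * t + c2 * t\<^sup>2"
proof (cases "c0 = 0")
  case True
  have "((\<lambda>t. c1 + c2 * t) \<longlongrightarrow> c1 + c2 * 0) (at_right 0)"
    by (intro tendsto_intros)
  then have "\<forall>\<^sub>F t in at_right 0. 0 < c1 + c2 * t"
    using assms(2)[OF True] by (auto dest: order_tendstoD(1))
  moreover have "\<forall>\<^sub>F t::real in at_right 0. 0 < t"
    by (simp add: eventually_at_right_less)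
  ultimately show ?thesis
  proof eventually_elim
    case (elim t)
    then have "0 < t * (c1 + c2 * t)" by simp
    then show ?case by (simp add: True algebra_simps power2_eq_square)
  qed
next
  case False
  have "((\<lambda>t. c0 + c1 * t + c2 * t\<^sup>2) \<longlongrightarrow> c0 + c1 * 0 + c2 * 0\<^sup>2) (at_right 0)"
    by (intro tendsto_intros)
  from order_tendstoD(1)[OF this, of 0] show ?thesis
    using assms(1) False by simp
qed

text \<open>The new cone is spanned by \<open>(1, \<alpha> t)\<close> and \<open>(\<beta> t, 1)\<close> for small \<open>t > 0\<close>. The entries of the
  conjugated matrices are quadratic in \<open>t\<close>, and the hypotheses make the linear coefficient
  positive whenever the constant one vanishes.\<close>

lemma conjugate_positive_if_directions:
  fixes A :: "'i \<Rightarrow> real^2^2"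
  assumes "finite I" "\<And>i. i \<in> I \<Longrightarrow> nonneg_mat (A i)"
    and "\<And>i. i \<in> I \<Longrightarrow> A i$1$1 = 0 \<Longrightarrow> \<beta> * A i$2$1 < \<alpha> * A i$1$2"
    and "\<And>i. i \<in> I \<Longrightarrow> A i$2$2 = 0 \<Longrightarrow> \<alpha> * A i$1$2 < \<beta> * A i$2$1"
    and "\<And>i. i \<in> I \<Longrightarrow> A i$2$1 = 0 \<Longrightarrow> 0 < \<alpha> * (A i$2$2 - A i$1$1)"
    and "\<And>i. i \<in> I \<Longrightarrow> A i$1$2 = 0 \<Longrightarrow> 0 < \<beta> * (A i$1$1 - A i$2$2)"
  shows "\<exists>P :: real^2^2. invertible P \<and> (\<forall>i\<in>I. pos_mat (P ** A i ** matrix_inv P))"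
proof -
  \<comment> \<open>These are the four entries of \<open>P ** A i ** Q\<close> below, without their
    common factor \<open>d\<close>.\<close>
  define E where "E = (\<lambda>i t. 
     0 < A i$1$1 + (\<alpha> * A i$1$2 - \<beta> * A i$2$1) * t + (- (\<alpha> * \<beta> * A i$2$2)) * t\<^sup>2 \<and>
     0 < A i$1$2 + (\<beta> * (A i$1$1 - A i$2$2)) * t + (- (\<beta>\<^sup>2 * A i$2$1)) * t\<^sup>2 \<and>
     0 < A i$2$1 + (\<alpha> * (A i$2$2 - A i$1$1)) * t + (- (\<alpha>\<^sup>2 * A i$1$2)) * t\<^sup>2 \<and>
     0 < A i$2$2 + (\<beta> * A i$2$1 - \<alpha> * A i$1$2) * t + (- (\<alpha> * \<beta> * A i$1$1)) * t\<^sup>2)"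
  have "\<forall>\<^sub>F t in at_right 0. \<forall>i\<in>I. E i t"
  proof (intro eventually_ball_finite assms(1) ballI)
    fix i assume "i \<in> I"
    then show "\<forall>\<^sub>F t in at_right 0. E i t"
      unfolding E_def using assms(2-)[OF \<open>i \<in> I\<close>]
      by (intro eventually_conj eventually_pos_quadratic) (auto simp: nonneg_mat_def)
  qed
  \<comment> \<open>This quadratic is the determinant of \<open>P\<close>.\<close>
  moreover have "\<forall>\<^sub>F t in at_right 0. 0 < 1 + 0 * t + (- (\<alpha> * \<beta>)) * t\<^sup>2"
    by (intro eventually_pos_quadratic) auto
  ultimately have "\<forall>\<^sub>F t in at_right 0. (\<forall>i\<in>I. E i t) \<and> 0 < 1 - \<alpha> * \<beta> * t\<^sup>2"
    by eventually_elim simp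
  then obtain t where t: "\<And>i. i \<in> I \<Longrightarrow> E i t" "0 < 1 - \<alpha> * \<beta> * t\<^sup>2"
    using eventually_happens'[OF trivial_limit_at_right_real] by blast
  define P :: "real^2^2" where "P = vector [vector [1, - (\<beta> * t)], vector [- (\<alpha> * t), 1]]"
  define d where "d = 1 / (1 - \<alpha> * \<beta> * t\<^sup>2)"
  \<comment> \<open>The columns of \<open>Q\<close> are positive multiples of the vectors spanning
    the new cone, so \<open>P ** A i ** Q\<close> is \<open>A i\<close> written in coordinates of
    that cone.\<close>
  define Q :: "real^2^2" where "Q = vector [vector [d, d * (\<beta> * t)], vector [d * (\<alpha> * t), d]]"
  have d: "0 < d" "d * (1 - \<alpha> * \<beta> * t\<^sup>2) = 1"
    using t(2) by (simp_all add: d_def)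
  have "P ** Q = mat 1" "Q ** P = mat 1"
    using d(2) by (simp_all add: P_def Q_def vec_2_eq_iff mult_mat_2 mat_def algebra_simps power2_eq_square)
  then have PQ: "invertible P" "matrix_inv P = Q"
    by (auto simp: invertible_def intro: matrix_inv_eqI)
  have "pos_mat (P ** A i ** matrix_inv P)" if "i \<in> I" for i
  proof -
    have "(P ** A i ** Q)$1$1 = d * (A i$1$1 + (\<alpha> * A i$1$2 - \<beta> * A i$2$1) * t + (- (\<alpha> * \<beta> * A i$2$2)) * t\<^sup>2)"
      "(P ** A i ** Q)$1$2 = d * (A i$1$2 + (\<beta> * (A i$1$1 - A i$2$2)) * t + (- (\<beta>\<^sup>2 * A i$2$1)) * t\<^sup>2)"
      "(P ** A i ** Q)$2$1 = d * (A i$2$1 + (\<alpha> * (A i$2$2 - A i$1$1)) * t + (- (\<alpha>\<^sup>2 * A i$1$2)) * t\<^sup>2)"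
      "(P ** A i ** Q)$2$2 = d * (A i$2$2 + (\<beta> * A i$2$1 - \<alpha> * A i$1$2) * t + (- (\<alpha> * \<beta> * A i$1$1)) * t\<^sup>2)"
      by (simp_all add: P_def Q_def mult_mat_2 algebra_simps power2_eq_square)
    then show ?thesis
      using t(1)[OF that] d(1) unfolding E_def PQ pos_mat_def forall_2 by simp
  qed
  with PQ(1) show ?thesis by blast
qed

text \<open>Only connections between the edges \<open>e1\<close> and \<open>e2\<close> of the
  quadrant are exploited. Attraction and repulsion at an edge restrict the sign of \<alpha> or
  \<beta>; matrices carrying one edge to the other bound \<alpha> in terms of \<beta>.\<close>

lemma ex_cone_directions:
  fixes A :: "'i \<Rightarrow> real^2^2"
  assumes fin: "finite I" and inv: "\<forall>i\<in>I. invertible (A i)"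
    and nonneg: "\<forall>i\<in>I. nonneg_mat (A i)"
    and no_conn: "\<not> gen_heteroclinic_connection 2 I A"
  obtains \<alpha> \<beta> where
    "\<And>i. i \<in> I \<Longrightarrow> A i$1$1 = 0 \<Longrightarrow> \<beta> * A i$2$1 < \<alpha> * A i$1$2"
    "\<And>i. i \<in> I \<Longrightarrow> A i$2$2 = 0 \<Longrightarrow> \<alpha> * A i$1$2 < \<beta> * A i$2$1"
    "\<And>i. i \<in> I \<Longrightarrow> A i$2$1 = 0 \<Longrightarrow> 0 < \<alpha> * (A i$2$2 - A i$1$1)"
    "\<And>i. i \<in> I \<Longrightarrow> A i$1$2 = 0 \<Longrightarrow> 0 < \<beta> * (A i$1$1 - A i$2$2)"
proof -
  note witness = that
  \<comment> \<open>Length 2 enters through a matrix taking \<open>e1\<close> to the line of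
    \<open>e2\<close> followed by one taking it back.\<close>
  define L where "L = {is \<in> lists I. 1 \<le> length is \<and> length is \<le> 2}"
  have L: "[i] \<in> L" "[i, j] \<in> L" if "i \<in> I" "j \<in> I" for i j
    using that by (simp_all add: L_def)
  have le_2: "enat n \<le> 2 \<longleftrightarrow> n \<le> 2" for n
    by (simp add: numeral_eq_enat)
  have conn: False if "us \<in> L" "ws \<in> L" "hs \<in> lists I" "length hs \<le> 2" "v \<noteq> 0"
    "word A us *v v = l *\<^sub>R v" "\<bar>det (word A us)\<bar> \<le> l\<^sup>2"
    "word A ws *v (word A hs *v v) = m *\<^sub>R (word A hs *v v)" "m\<^sup>2 \<le> \<bar>det (word A ws)\<bar>"
    for us ws hs v l m
    using no_conn that unfolding gen_heteroclinic_connection_iff[OF inv] L_def le_2 mem_Collect_eq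
    by blast
  \<comment> \<open>A word with eigenvector \<open>e1\<close> is upper triangular, its eigenvalue
    there is the first diagonal entry, and the multiplier is the second diagonal entry over the
    first. At \<open>e2\<close> the roles of the two entries are exchanged.\<close>
  define att1 where "att1 \<longleftrightarrow> (\<exists>us\<in>L. word A us$2$1 = 0 \<and> \<bar>word A us$2$2\<bar> \<le> \<bar>word A us$1$1\<bar>)"
  define rep1 where "rep1 \<longleftrightarrow> (\<exists>us\<in>L. word A us$2$1 = 0 \<and> \<bar>word A us$1$1\<bar> \<le> \<bar>word A us$2$2\<bar>)"
  define att2 where "att2 \<longleftrightarrow> (\<exists>us\<in>L. word A us$1$2 = 0 \<and> \<bar>word A us$1$1\<bar> \<le> \<bar>word A us$2$2\<bar>)"
  define rep2 where "rep2 \<longleftrightarrow> (\<exists>us\<in>L. word A us$1$2 = 0 \<and> \<bar>word A us$2$2\<bar> \<le> \<bar>word A us$1$1\<bar>)"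
  define e1 :: "real^2" where "e1 = vector [1, 0]"
  define e2 :: "real^2" where "e2 = vector [0, 1]"
  have e_nz: "e1 \<noteq> 0" "e2 \<noteq> 0"
    by (simp_all add: e1_def e2_def vec_2_eq_iff)
  have eig1: "M *v (c *\<^sub>R e1) = M$1$1 *\<^sub>R c *\<^sub>R e1" "M *v e1 = M$1$1 *\<^sub>R e1" "det M = M$1$1 * M$2$2"
    if "M$2$1 = 0" for M c
    using that by (simp_all add: e1_def vec_2_eq_iff mult_vec_2 det_2)
  have eig2: "M *v (c *\<^sub>R e2) = M$2$2 *\<^sub>R c *\<^sub>R e2" "M *v e2 = M$2$2 *\<^sub>R e2" "det M = M$1$1 * M$2$2"
    if "M$1$2 = 0" for M c
    using that by (simp_all add: e2_def vec_2_eq_iff mult_vec_2 det_2)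
  have sq: "\<bar>x * y\<bar> \<le> x\<^sup>2" "\<bar>y * x\<bar> \<le> x\<^sup>2" "y\<^sup>2 \<le> \<bar>x * y\<bar>" "y\<^sup>2 \<le> \<bar>y * x\<bar>" if "\<bar>y\<bar> \<le> \<bar>x\<bar>" for x y :: real
  proof -
    have "\<bar>y\<bar> * \<bar>y\<bar> \<le> \<bar>x\<bar> * \<bar>y\<bar>" "\<bar>x\<bar> * \<bar>y\<bar> \<le> \<bar>x\<bar> * \<bar>x\<bar>"
      using that by (rule mult_right_mono, simp) (use that in \<open>rule mult_left_mono, simp\<close>)
    then show "\<bar>x * y\<bar> \<le> x\<^sup>2" "\<bar>y * x\<bar> \<le> x\<^sup>2" "y\<^sup>2 \<le> \<bar>x * y\<bar>" "y\<^sup>2 \<le> \<bar>y * x\<bar>"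
      by (simp_all add: power2_eq_square abs_mult mult.commute)
  qed
  \<comment> \<open>An edge that both attracts and repels is a connection with
    \<open>h = id\<close>, given by the empty word.\<close>
  have n1: "\<not> (att1 \<and> rep1)"
    unfolding att1_def rep1_def
  proof safe
    fix us ws assume "us \<in> L" "ws \<in> L" "word A us$2$1 = 0" "word A ws$2$1 = 0"
      "\<bar>word A us$2$2\<bar> \<le> \<bar>word A us$1$1\<bar>" "\<bar>word A ws$1$1\<bar> \<le> \<bar>word A ws$2$2\<bar>"
    then show False
      by (intro conn[of us ws "[]" e1]) (auto simp: e_nz eig1 word_simps intro: sq)
  qed
  have n2: "\<not> (att2 \<and> rep2)"
    unfolding att2_def rep2_def
  proof safe
    fix us ws assume "us \<in> L" "ws \<in> L" "word A us$1$2 = 0" "word A ws$1$2 = 0"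
      "\<bar>word A us$1$1\<bar> \<le> \<bar>word A us$2$2\<bar>" "\<bar>word A ws$2$2\<bar> \<le> \<bar>word A ws$1$1\<bar>"
    then show False
      by (intro conn[of us ws "[]" e2]) (auto simp: e_nz eig2 word_simps intro: sq)
  qed
  \<comment> \<open>Here \<open>A i\<close> moves \<open>e1\<close> onto the line of
    \<open>e2\<close>, so the one-letter word \<open>[i]\<close> provides \<open>h\<close>.\<close>
  have n12: "\<not> (att1 \<and> rep2)" if "i \<in> I" "A i$1$1 = 0" for i
    unfolding att1_def rep2_def
  proof safe
    have i: "A i *v e1 = A i$2$1 *\<^sub>R e2"
      using that by (simp add: e1_def e2_def vec_2_eq_iff mult_vec_2)
    fix us ws assume "us \<in> L" "ws \<in> L" "word A us$2$1 = 0" "word A ws$1$2 = 0"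
      "\<bar>word A us$2$2\<bar> \<le> \<bar>word A us$1$1\<bar>" "\<bar>word A ws$2$2\<bar> \<le> \<bar>word A ws$1$1\<bar>"
    then show False
      by (intro conn[of us ws "[i]" e1]) (auto simp: e_nz eig1 eig2 word_simps i that intro: sq)
  qed
  have n21: "\<not> (att2 \<and> rep1)" if "i \<in> I" "A i$2$2 = 0" for i
    unfolding att2_def rep1_def
  proof safe
    have i: "A i *v e2 = A i$1$2 *\<^sub>R e1"
      using that by (simp add: e1_def e2_def vec_2_eq_iff mult_vec_2)
    fix us ws assume "us \<in> L" "ws \<in> L" "word A us$1$2 = 0" "word A ws$2$1 = 0"
      "\<bar>word A us$1$1\<bar> \<le> \<bar>word A us$2$2\<bar>" "\<bar>word A ws$1$1\<bar> \<le> \<bar>word A ws$2$2\<bar>"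
    then show False
      by (intro conn[of us ws "[i]" e2]) (auto simp: e_nz eig1 eig2 word_simps i that intro: sq)
  qed
  have ge0: "0 \<le> A i$j$k" if "i \<in> I" for i j k
    using nonneg that by (simp add: nonneg_mat_def)
  have det_nz: "A i$1$1 * A i$2$2 \<noteq> A i$1$2 * A i$2$1" if "i \<in> I" for i
    using inv that by (simp add: invertible_det_nz det_2)
  \<comment> \<open>With a zero on the diagonal, the determinant is minus the off-diagonal product,
    so neither factor vanishes.\<close>
  have off_pos: "0 < A i$1$2" "0 < A i$2$1" if "i \<in> I" "A i$1$1 = 0 \<or> A i$2$2 = 0" for i
    using det_nz[OF that(1)] ge0[OF that(1)] that(2) by (auto simp: order_less_le)
  have single1: "A i$2$2 \<le> A i$1$1 \<Longrightarrow> att1" "A i$1$1 \<le> A i$2$2 \<Longrightarrow> rep1"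
    if "i \<in> I" "A i$2$1 = 0" for i
    unfolding att1_def rep1_def using that L(1)[OF that(1,1)] ge0[OF that(1)]
    by (auto simp: word_simps intro!: bexI[of _ "[i]"])
  have single2: "A i$1$1 \<le> A i$2$2 \<Longrightarrow> att2" "A i$2$2 \<le> A i$1$1 \<Longrightarrow> rep2"
    if "i \<in> I" "A i$1$2 = 0" for i
    unfolding att2_def rep2_def using that L(1)[OF that(1,1)] ge0[OF that(1)]
    by (auto simp: word_simps intro!: bexI[of _ "[i]"])
  \<comment> \<open>The word \<open>[i, j]\<close> fixes the line of \<open>e1\<close> and
    \<open>[j, i]\<close> that of \<open>e2\<close>. Their diagonals consist of the same two
    products in opposite order, so one comparison decides the behaviour at both edges.\<close>
  have pair: "A j$2$1 * A i$1$2 \<le> A j$1$2 * A i$2$1 \<Longrightarrow> att1 \<and> att2"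
      "A j$1$2 * A i$2$1 \<le> A j$2$1 * A i$1$2 \<Longrightarrow> rep1 \<and> rep2"
    if ij: "i \<in> I" "j \<in> I" "A i$1$1 = 0" "A j$2$2 = 0" for i j
  proof -
    have W: "word A [i, j]$2$1 = 0" "word A [i, j]$1$1 = A j$1$2 * A i$2$1" "word A [i, j]$2$2 = A j$2$1 * A i$1$2"
      "word A [j, i]$1$2 = 0" "word A [j, i]$1$1 = A j$2$1 * A i$1$2" "word A [j, i]$2$2 = A j$1$2 * A i$2$1"
      using ij by (simp_all add: word_simps mult_mat_2)
    have "0 \<le> A j$2$1 * A i$1$2" "0 \<le> A j$1$2 * A i$2$1"
      using ge0 ij by simp_all
    then show "A j$2$1 * A i$1$2 \<le> A j$1$2 * A i$2$1 \<Longrightarrow> att1 \<and> att2"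
      "A j$1$2 * A i$2$1 \<le> A j$2$1 * A i$1$2 \<Longrightarrow> rep1 \<and> rep2"
      unfolding att1_def att2_def rep1_def rep2_def
      using L(2)[OF ij(1,2)] L(2)[OF ij(2,1)] W by (metis abs_of_nonneg)+
  qed
  \<comment> \<open>Dividing by \<open>A i$1$2 > 0\<close> turns the inequalities for a zero
    diagonal entry into comparisons of \<alpha> with \<open>\<beta> * k i\<close>.\<close>
  define k where "k i = A i$2$1 / A i$1$2" for i
  define S1 where "S1 = {i \<in> I. A i$1$1 = 0}"
  define S2 where "S2 = {i \<in> I. A i$2$2 = 0}"
  have S: "finite S1" "finite S2" using fin by (simp_all add: S1_def S2_def)
  have k_pos: "0 < k i" if "i \<in> S1 \<union> S2" for i
    using off_pos that by (auto simp: k_def S1_def S2_def)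
  have pairk: "k j \<le> k i \<Longrightarrow> att1 \<and> att2" "k i \<le> k j \<Longrightarrow> rep1 \<and> rep2" if "i \<in> S1" "j \<in> S2" for i j
    using pair[of i j] off_pos[of i] off_pos[of j] that by (auto simp: k_def S1_def S2_def field_simps)
  \<comment> \<open>If \<open>att1\<close> fails, every single matrix fixing the line of
    \<open>e1\<close> has the larger diagonal entry in position 2, as a positive \<alpha> requires;
    if \<open>rep1\<close> fails, it is in position 1, which suits a negative \<alpha>. The same
    holds for \<beta> at \<open>e2\<close>. In the instances of \<open>goal\<close> below, \<beta>
    is given first and \<alpha> second.\<close>
  have goal: ?thesis if
    "\<And>i. i \<in> S1 \<Longrightarrow> \<beta> * k i < \<alpha>"
    "\<And>i. i \<in> S2 \<Longrightarrow> \<alpha> < \<beta> * k i"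
    "0 < \<alpha> \<and> \<not> att1 \<or> \<alpha> < 0 \<and> \<not> rep1"
    "0 < \<beta> \<and> \<not> att2 \<or> \<beta> < 0 \<and> \<not> rep2" for \<alpha> \<beta>
  proof (rule witness[of \<beta> \<alpha>])
    fix i assume i: "i \<in> I"
    show "\<beta> * A i$2$1 < \<alpha> * A i$1$2" if "A i$1$1 = 0"
      using \<open>\<And>i. i \<in> S1 \<Longrightarrow> \<beta> * k i < \<alpha>\<close>[of i] off_pos[OF i] i that by (simp add: S1_def k_def field_simps)
    show "\<alpha> * A i$1$2 < \<beta> * A i$2$1" if "A i$2$2 = 0"
      using \<open>\<And>i. i \<in> S2 \<Longrightarrow> \<alpha> < \<beta> * k i\<close>[of i] off_pos[OF i] i that by (simp add: S2_def k_def field_simps)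
    show "0 < \<alpha> * (A i$2$2 - A i$1$1)" if "A i$2$1 = 0"
      using \<open>0 < \<alpha> \<and> \<not> att1 \<or> \<alpha> < 0 \<and> \<not> rep1\<close> single1[OF i that]
      by (fastforce simp: zero_less_mult_iff)
    show "0 < \<beta> * (A i$1$1 - A i$2$2)" if "A i$1$2 = 0"
      using \<open>0 < \<beta> \<and> \<not> att2 \<or> \<beta> < 0 \<and> \<not> rep2\<close> single2[OF i that]
      by (fastforce simp: zero_less_mult_iff)
  qed
  have sep: "\<exists>K>0. (\<forall>i\<in>X. k i < K) \<and> (\<forall>j\<in>Y. K < k j)"
    if "X \<subseteq> S1 \<union> S2" "Y \<subseteq> S1 \<union> S2" "\<And>i j. i \<in> X \<Longrightarrow> j \<in> Y \<Longrightarrow> k i < k j" for X Y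
  proof -
    have "finite X" "finite Y"
      using that S finite_subset by blast+
    then have "\<exists>K>0. (\<forall>s\<in>k ` X. s < K) \<and> (\<forall>t\<in>k ` Y. K < t)"
      using that k_pos by (intro ex_separating_positive_real[of "k ` X" "k ` Y"]) auto
    then show ?thesis by blast
  qed
  \<comment> \<open>\<open>\<alpha> > 0\<close> shrinks the quadrant at \<open>e1\<close>, \<open>\<alpha> < 0\<close> enlarges it; likewise \<open>\<beta>\<close> at \<open>e2\<close>.\<close>
  consider "S1 = {}" "S2 = {}" | "S1 \<noteq> {}" "S2 = {}" | "S1 = {}" "S2 \<noteq> {}" | "S1 \<noteq> {}" "S2 \<noteq> {}"
    by blast
  then show ?thesis
  proof cases
    \<comment> \<open>No matrix carries one edge to the other, so the two signs are chosen
      independently.\<close>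
    case 1
    with n1 n2 show ?thesis
      by (intro goal[of "if att2 then -1 else 1" "if att1 then -1 else 1"]) auto
  next
    case 2
    then have n: "\<not> (att1 \<and> rep2)" using n12 by (auto simp: S1_def)
    obtain K where K: "0 < K" "\<And>i. i \<in> S1 \<Longrightarrow> k i < K"
      using sep[of S1 "{}"] by blast
    obtain \<kappa> where \<kappa>: "0 < \<kappa>" "\<And>i. i \<in> S1 \<Longrightarrow> \<kappa> < k i"
      using sep[of "{}" S1] by blast
    \<comment> \<open>If \<open>e1\<close> attracts, neither edge repels and the quadrant is
      enlarged at both, with \<alpha> small in absolute value. Otherwise a large positive \<alpha>
      works with either sign of \<beta>.\<close>
    show ?thesis
    proof (cases att1)
      case True
      with n n1 2 \<kappa> show ?thesis by (intro goal[of "-1" "-\<kappa>"]) auto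
    next
      case False
      have "- k i < K" if "i \<in> S1" for i
        using K(1) k_pos[of i] that by simp
      with False n2 2 K show ?thesis by (intro goal[of "if att2 then -1 else 1" K]) auto
    qed
  next
    case 3
    then have n: "\<not> (att2 \<and> rep1)" using n21 by (auto simp: S2_def)
    obtain K where K: "0 < K" "\<And>i. i \<in> S2 \<Longrightarrow> k i < K"
      using sep[of S2 "{}"] by blast
    obtain \<kappa> where \<kappa>: "0 < \<kappa>" "\<And>i. i \<in> S2 \<Longrightarrow> \<kappa> < k i"
      using sep[of "{}" S2] by blast
    \<comment> \<open>If \<open>e2\<close> attracts, neither edge repels and the quadrant is
      enlarged at both, now with \<alpha> large in absolute value. Otherwise \<beta> is 1, and
      \<alpha> is either negative or below every ratio.\<close>
    show ?thesis
    proof (cases att2)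
      case True
      with n n2 3 K show ?thesis by (intro goal[of "-1" "-K"]) auto
    next
      case False
      have "-1 < k i" if "i \<in> S2" for i
        using k_pos[of i] that by simp
      with False n1 3 \<kappa> show ?thesis by (intro goal[of 1 "if att1 then -1 else \<kappa>"]) auto
    qed
  next
    case 4
    then obtain i j where ij: "i \<in> S1" "j \<in> S2" by blast
    have n: "\<not> (att1 \<and> rep2)" "\<not> (att2 \<and> rep1)"
      using n12[of i] n21[of j] ij by (auto simp: S1_def S2_def)
    show ?thesis
    proof (cases att1)
      \<comment> \<open>Now neither edge repels, so \<open>pairk\<close> separates the ratios and
        both edges are pushed outwards.\<close>
      case True
      then have "\<And>i j. i \<in> S1 \<Longrightarrow> j \<in> S2 \<Longrightarrow> k j < k i"
        using pairk(2) n1 not_le by blast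
      then obtain \<kappa> where \<kappa>: "0 < \<kappa>" "\<And>i. i \<in> S1 \<Longrightarrow> \<kappa> < k i" "\<And>j. j \<in> S2 \<Longrightarrow> k j < \<kappa>"
        using sep[of S2 S1] by blast
      with True n n1 show ?thesis by (intro goal[of "-1" "-\<kappa>"]) auto
    next
      \<comment> \<open>The ratios are separated in the opposite order. The same words then make
        \<open>e1\<close> repelling, which excludes \<open>att2\<close>, and both edges are pushed
        inwards.\<close>
      case False
      then have "\<And>i j. i \<in> S1 \<Longrightarrow> j \<in> S2 \<Longrightarrow> k i < k j"
        using pairk(1) not_le by blast
      moreover then have "rep1" using pairk(2) ij order_less_imp_le by blast
      ultimately obtain \<kappa> where \<kappa>: "0 < \<kappa>" "\<And>i. i \<in> S1 \<Longrightarrow> k i < \<kappa>" "\<And>j. j \<in> S2 \<Longrightarrow> \<kappa> < k j"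
        using sep[of S1 S2] by blast
      with False n \<open>rep1\<close> show ?thesis by (intro goal[of 1 \<kappa>]) auto
    qed
  qed
qed

section \<open>Conjugates of positive matrices have no connections\<close>

text \<open>With slope \<open>t = v$2 / v$1\<close>, the other eigenvalue is
  \<open>s - q * t\<close>, while \<open>l = p + q * t = s + r / t\<close>. For \<open>t > 0\<close>
  this makes \<open>l\<close> strictly dominant in absolute value, for \<open>t < 0\<close> strictly
  dominated. Comparing \<open>l^2\<close> with the absolute determinant compares these two
  eigenvalues.\<close>

lemma eigenvector_pos_mat:
  assumes "pos_mat M" "invertible M" "v \<noteq> 0" "M *v v = l *\<^sub>R v"
  shows "\<bar>det M\<bar> \<le> l\<^sup>2 \<Longrightarrow> 0 < v$1 * v$2" "l\<^sup>2 \<le> \<bar>det M\<bar> \<Longrightarrow> v$1 * v$2 < 0"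
proof -
  define p q r s where "p = M$1$1" "q = M$1$2" "r = M$2$1" "s = M$2$2"
  note pqrs = this
  have pos: "0 < p" "0 < q" "0 < r" "0 < s"
    using assms(1) by (simp_all add: pos_mat_def pqrs)
  have eig: "p * v$1 + q * v$2 = l * v$1" "r * v$1 + s * v$2 = l * v$2"
    using assms(4) by (simp_all add: vec_2_eq_iff mult_vec_2 pqrs)
  have nz: "v$1 \<noteq> 0" "v$2 \<noteq> 0"
    using eig assms(3) pos by (auto simp: vec_2_eq_iff)
  define t where "t = v$2 / v$1"
  have l1: "l = p + q * t" and l2: "l * t = r + s * t" and "t \<noteq> 0"
    using eig nz by (simp_all add: t_def field_simps)
  have "det M = p * s - q * r"
    by (simp add: det_2 pqrs)
  also have "\<dots> = (l - q * t) * s - q * (l * t - s * t)"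
    using l1 l2 by simp
  also have "\<dots> = l * (s - q * t)"
    by (simp add: algebra_simps)
  finally have det: "det M = l * (s - q * t)" .
  have l3: "l = s + r / t"
    using l2 \<open>t \<noteq> 0\<close> by (simp add: field_simps)
  have "l \<noteq> 0"
    using det assms(2) by (auto simp: invertible_det_nz)
  have sgn: "0 < t \<longleftrightarrow> 0 < v$1 * v$2" "t < 0 \<longleftrightarrow> v$1 * v$2 < 0"
    by (auto simp: t_def zero_less_divide_iff zero_less_mult_iff divide_less_0_iff mult_less_0_iff)
  have abs_det: "\<bar>det M\<bar> = \<bar>l\<bar> * \<bar>s - q * t\<bar>" "l\<^sup>2 = \<bar>l\<bar> * \<bar>l\<bar>"
    by (simp_all add: det abs_mult power2_eq_square)
  have "\<bar>s - q * t\<bar> < \<bar>l\<bar>" if "0 < t"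
  proof -
    have "0 < q * t" "0 < r / t" using that pos by simp_all
    then show "\<bar>s - q * t\<bar> < \<bar>l\<bar>"
      using l1 l3 pos by linarith
  qed
  moreover have "\<bar>l\<bar> < \<bar>s - q * t\<bar>" if "t < 0"
  proof -
    have "q * t < 0" "r / t < 0" using that pos by (simp_all add: mult_pos_neg divide_pos_neg)
    then show "\<bar>l\<bar> < \<bar>s - q * t\<bar>"
      using l1 l3 pos by linarith
  qed
  moreover have "0 < \<bar>l\<bar>" using \<open>l \<noteq> 0\<close> by simp
  ultimately have "0 < t \<Longrightarrow> \<bar>det M\<bar> < l\<^sup>2" "t < 0 \<Longrightarrow> l\<^sup>2 < \<bar>det M\<bar>"
    unfolding abs_det by (blast intro: mult_strict_left_mono)+
  then show "\<bar>det M\<bar> \<le> l\<^sup>2 \<Longrightarrow> 0 < v$1 * v$2" "l\<^sup>2 \<le> \<bar>det M\<bar> \<Longrightarrow> v$1 * v$2 < 0"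
    using \<open>t \<noteq> 0\<close> unfolding sgn[symmetric] by linarith+
qed

lemma pos_mat_mult: "pos_mat M \<Longrightarrow> pos_mat N \<Longrightarrow> pos_mat (M ** N)"
  by (simp add: pos_mat_def mult_mat_2 add_pos_pos)

text \<open>The product condition describes the open first quadrant together with its negative; a
  positive matrix preserves each of the two.\<close>

lemma pos_mat_mult_vec:
  assumes "pos_mat M" "0 < v$1 * v$2"
  shows "0 < (M *v v)$1 * (M *v v)$2"
proof -
  have pos: "0 < M$i$j" for i j
    using assms(1) by (simp add: pos_mat_def)
  have "(0 < v$1 \<and> 0 < v$2) \<or> (v$1 < 0 \<and> v$2 < 0)"
    using assms(2) by (auto simp: zero_less_mult_iff)
  then show ?thesis
  proof
    assume "0 < v$1 \<and> 0 < v$2"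
    then show ?thesis
      using pos by (intro mult_pos_pos) (auto simp: mult_vec_2 intro!: add_pos_pos)
  next
    assume "v$1 < 0 \<and> v$2 < 0"
    then show ?thesis
      using pos by (intro mult_neg_neg) (auto simp: mult_vec_2 intro!: add_neg_neg mult_pos_neg)
  qed
qed

lemma conjugate_mult:
  fixes P M N :: "real^2^2"
  assumes "invertible P"
  shows "P ** (M ** N) ** matrix_inv P = (P ** M ** matrix_inv P) ** (P ** N ** matrix_inv P)"
proof -
  have "matrix_inv P ** P = mat 1"
    using assms by (rule matrix_inv_mult)
  then have "P ** M ** (matrix_inv P ** P) ** N ** matrix_inv P = P ** M ** N ** matrix_inv P"
    by simp
  then show ?thesis by (simp add: matrix_mul_assoc)
qed

text \<open>After conjugation, nonempty words are positive matrices. An attracting eigenvector has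
  coordinates of equal sign, this persists under words, and a repelling one has coordinates of
  opposite sign. The argument is independent of the depth.\<close>

lemma no_connection_if_conjugate_positive:
  fixes A :: "'i \<Rightarrow> real^2^2"
  assumes inv: "\<forall>i\<in>I. invertible (A i)" and P: "invertible P"
    and pos: "\<forall>i\<in>I. pos_mat (P ** A i ** matrix_inv P)"
  shows "\<not> gen_heteroclinic_connection k I A"
proof
  define conj where "conj M = P ** M ** matrix_inv P" for M
  have PI: "P ** matrix_inv P = mat 1" "matrix_inv P ** P = mat 1"
    using P by (simp_all add: matrix_inv_mult)
  have conj_vec: "conj M *v (P *v v) = P *v (M *v v)" for M v
  proof -
    have "conj M *v (P *v v) = (P ** M ** (matrix_inv P ** P)) *v v"
      by (simp only: conj_def matrix_vector_mul_assoc matrix_mul_assoc)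
    then show ?thesis by (simp add: PI matrix_vector_mul_assoc)
  qed
  have "det P * det (matrix_inv P) = 1"
    using arg_cong[OF PI(1), of det] by (simp add: det_mul)
  then have det_conj: "det (conj M) = det M" for M
    by (simp add: conj_def det_mul)
  have inv_conj: "invertible (conj (word A is))" if "is \<in> lists I" for "is"
    using invertible_word[OF inv that] by (simp add: invertible_det_nz det_conj)
  \<comment> \<open>The empty word gives the identity, which is not positive; hence the separate
    treatment of \<open>hs = []\<close> below.\<close>
  have pos_word: "pos_mat (conj (word A is))" if "is \<in> lists I" "1 \<le> length is" for "is"
  proof -
    have "is \<noteq> []" using that(2) by auto
    then show ?thesis using that(1)
    proof (induction "is" rule: rev_nonempty_induct)
      case (single i)
      then show ?case using pos by (simp add: word_simps conj_def)
    next
      case (snoc i "is")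
      have "conj (word A (is @ [i])) = conj (A i) ** conj (word A is)"
        unfolding conj_def word_simps by (rule conjugate_mult[OF P])
      then show ?case
        using snoc pos by (simp add: pos_mat_mult flip: conj_def)
    qed
  qed
  assume "gen_heteroclinic_connection k I A"
  then obtain us hs ws v l m where conn: "us \<in> lists I" "hs \<in> lists I" "ws \<in> lists I"
      "1 \<le> length us" "1 \<le> length ws" "v \<noteq> 0"
      "word A us *v v = l *\<^sub>R v" "\<bar>det (word A us)\<bar> \<le> l\<^sup>2"
      "word A ws *v (word A hs *v v) = m *\<^sub>R (word A hs *v v)" "m\<^sup>2 \<le> \<bar>det (word A ws)\<bar>"
    unfolding gen_heteroclinic_connection_iff[OF inv] by blast
  define w where "w = P *v v"
  define z where "z = P *v (word A hs *v v)"
  have w: "w \<noteq> 0" "conj (word A us) *v w = l *\<^sub>R w"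
    using mult_vec_nonzero[OF P] conn by (simp_all add: w_def conj_vec matrix_vector_mult_scaleR)
  have z: "z \<noteq> 0" "conj (word A ws) *v z = m *\<^sub>R z" "z = conj (word A hs) *v w"
    using mult_vec_nonzero[OF P] mult_vec_nonzero[OF invertible_word[OF inv]] conn
    by (simp_all add: w_def z_def conj_vec matrix_vector_mult_scaleR)
  have "0 < w$1 * w$2"
    using eigenvector_pos_mat(1)[OF pos_word inv_conj w] conn by (simp add: det_conj)
  then have "0 < z$1 * z$2"
  proof (cases "hs = []")
    case True
    then show ?thesis
      using \<open>0 < w$1 * w$2\<close> by (simp add: z_def w_def word_simps)
  next
    case False
    then have "1 \<le> length hs" by (cases hs) auto
    then show ?thesis
      unfolding z(3) using conn(2) \<open>0 < w$1 * w$2\<close> by (intro pos_mat_mult_vec pos_word)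
  qed
  moreover have "z$1 * z$2 < 0"
    using eigenvector_pos_mat(2)[OF pos_word inv_conj z(1,2)] conn by (simp add: det_conj)
  ultimately show False by simp
qed

section \<open>Arcs on the projective line\<close>

lemma topspace_rhat: "topspace rhat_top = UNIV"
  by (simp add: UNIV_option_conv)

lemma insert_None_image_Compl: "insert None (Some ` (UNIV - C)) = UNIV - Some ` C"
proof (rule set_eqI)
  fix p show "p \<in> insert None (Some ` (UNIV - C)) \<longleftrightarrow> p \<in> UNIV - Some ` C"
    by (cases p) auto
qed

text \<open>By Heine-Borel, complements of compact sets are exactly the neighbourhoods of infinity
  that are open on the line and contain all numbers of large absolute value. Continuity at infinity
  thereby becomes an estimate.\<close>

lemma openin_rhat_iff:
  "openin rhat_top U \<longleftrightarrow>
    open {x. Some x \<in> U} \<and> (None \<in> U \<longrightarrow> (\<exists>R. \<forall>x. R < \<bar>x\<bar> \<longrightarrow> Some x \<in> U))"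
proof
  assume "openin rhat_top U"
  then have "(\<exists>V. open V \<and> U = Some ` V) \<or> (\<exists>C. compact C \<and> U = - Some ` C)"
    unfolding openin_Alexandroff_compactification topspace_rhat
    by (elim disj_forward ex_forward) (simp_all add: Compl_eq_Diff_UNIV insert_None_image_Compl)
  then consider V where "open V" "U = Some ` V"
    | C where "compact C" "U = - Some ` C"
    by blast
  then show "open {x. Some x \<in> U} \<and> (None \<in> U \<longrightarrow> (\<exists>R. \<forall>x. R < \<bar>x\<bar> \<longrightarrow> Some x \<in> U))"
  proof cases
    case 1
    then have "{x. Some x \<in> U} = V" "None \<notin> U" by auto
    with 1 show ?thesis by simp
  next
    case 2
    then have "{x. Some x \<in> U} = - C" by auto
    moreover obtain R where "\<And>x. x \<in> C \<Longrightarrow> \<bar>x\<bar> \<le> R"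
      using compact_imp_bounded[OF \<open>compact C\<close>] by (auto simp: bounded_iff)
    then have "\<forall>x. R < \<bar>x\<bar> \<longrightarrow> Some x \<in> U"
      using 2 by force
    ultimately show ?thesis
      using compact_imp_closed[OF \<open>compact C\<close>] by (auto simp: open_closed)
  qed
next
  assume R: "open {x. Some x \<in> U} \<and> (None \<in> U \<longrightarrow> (\<exists>R. \<forall>x. R < \<bar>x\<bar> \<longrightarrow> Some x \<in> U))"
  show "openin rhat_top U"
  proof (cases "None \<in> U")
    case True
    with R obtain r where "\<And>x. Some x \<notin> U \<Longrightarrow> \<bar>x\<bar> \<le> r"
      by (meson not_le)
    moreover have "closed {x. Some x \<notin> U}"
      using R by (simp add: closed_def Compl_eq)
    ultimately have "compact {x. Some x \<notin> U}"
      unfolding compact_eq_bounded_closed bounded_iff by auto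
    moreover have "U = UNIV - Some ` {x. Some x \<notin> U}"

    proof (rule set_eqI)
      fix p show "p \<in> U \<longleftrightarrow> p \<in> UNIV - Some ` {x. Some x \<notin> U}"
        using True by (cases p) auto
    qed
    ultimately show ?thesis
      unfolding openin_Alexandroff_compactification topspace_euclidean insert_None_image_Compl
      by (intro disjI2 exI[of _ "{x. Some x \<notin> U}"]) (simp add: compact_imp_closed)
  next
    case False
    have "U = Some ` {x. Some x \<in> U}"
    proof (rule set_eqI)
      fix p show "p \<in> U \<longleftrightarrow> p \<in> Some ` {x. Some x \<in> U}"
        using False by (cases p) auto
    qed
    moreover have "openin rhat_top (Some ` {x. Some x \<in> U})"
      using R by simp
    ultimately show ?thesis by simp
  qed
qed

lemma continuous_map_rhat_iff:
  "continuous_map rhat_top rhat_top g \<longleftrightarrow> (\<forall>U. openin rhat_top U \<longrightarrow> openin rhat_top (g -` U))"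
  unfolding continuous_map_def topspace_rhat by (simp add: vimage_def)

lemma continuous_map_rhat_inverse: "continuous_map rhat_top rhat_top rhat_inverse"
  unfolding continuous_map_rhat_iff
proof (intro allI impI)
  fix U assume "openin rhat_top U"
  define W where "W = {x. Some x \<in> U}"
  have W: "open W" and inf: "None \<in> U \<Longrightarrow> \<exists>R. \<forall>x. R < \<bar>x\<bar> \<longrightarrow> x \<in> W"
    using \<open>openin rhat_top U\<close> by (auto simp: openin_rhat_iff W_def)
  have "open (- {0} \<inter> (\<lambda>x::real. 1 / x) -` W)"
    using W by (intro continuous_open_preimage continuous_intros) auto
  then have ow: "open {x. x \<noteq> 0 \<and> 1 / x \<in> W}"
    by (simp add: vimage_def Int_def)
  have "open {x. Some x \<in> rhat_inverse -` U}"
  proof (cases "None \<in> U")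
    case True
    then obtain R where R: "\<And>x. R < \<bar>x\<bar> \<Longrightarrow> x \<in> W" using inf by blast
    \<comment> \<open>The shift by 1 and the absolute value keep the radius of the ball around 0
      positive for every real \<open>R\<close>.\<close>
    have "1 / x \<in> W" if "x \<noteq> 0" "\<bar>x\<bar> < 1 / (\<bar>R\<bar> + 1)" for x
    proof (rule R)
      have "\<bar>x\<bar> * (\<bar>R\<bar> + 1) < 1" using that(2) by (simp add: field_simps)
      then have "\<bar>R\<bar> + 1 < 1 / \<bar>x\<bar>" using that(1) by (simp add: field_simps)
      then show "R < \<bar>1 / x\<bar>" by simp
    qed
    then have "{x. Some x \<in> rhat_inverse -` U} = {x. x \<noteq> 0 \<and> 1 / x \<in> W} \<union> ball 0 (1 / (\<bar>R\<bar> + 1))"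
      using True by (auto simp: rhat_inverse_def W_def)
    then show ?thesis using open_Un[OF ow open_ball] by (simp only:)
  next
    case False
    then have "{x. Some x \<in> rhat_inverse -` U} = {x. x \<noteq> 0 \<and> 1 / x \<in> W}"
      by (auto simp: rhat_inverse_def W_def split: if_splits)
    then show ?thesis using ow by simp
  qed
  moreover have "\<exists>R. \<forall>x. R < \<bar>x\<bar> \<longrightarrow> Some x \<in> rhat_inverse -` U" if "None \<in> rhat_inverse -` U"
  proof -
    have "0 \<in> W" using that by (simp add: rhat_inverse_def W_def)
    then obtain e where e: "0 < e" "\<And>x. \<bar>x\<bar> < e \<Longrightarrow> x \<in> W"
      using W by (auto simp: open_contains_ball subset_eq)
    have "Some x \<in> rhat_inverse -` U" if "1 / e < \<bar>x\<bar>" for x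
    proof -
      have "x \<noteq> 0" using that e(1) by (auto simp: field_simps)
      moreover have "\<bar>1 / x\<bar> < e"
        using that e(1) \<open>x \<noteq> 0\<close> by (simp add: field_simps)
      ultimately show ?thesis
        using e(2)[of "1 / x"] by (simp add: rhat_inverse_def W_def)
    qed
    then show ?thesis by blast
  qed
  ultimately show "openin rhat_top (rhat_inverse -` U)"
    by (simp add: openin_rhat_iff)
qed

lemma continuous_map_rhat_affine:
  assumes "a \<noteq> 0"
  shows "continuous_map rhat_top rhat_top (map_option (\<lambda>x. a * x + b))"
  unfolding continuous_map_rhat_iff
proof (intro allI impI)
  fix U :: "rhat set"
  let ?g = "map_option (\<lambda>x. a * x + b)"
  assume U: "openin rhat_top U"
  then have "open ((\<lambda>x. a * x + b) -` {x. Some x \<in> U})"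
    by (intro open_vimage continuous_intros) (simp add: openin_rhat_iff)
  moreover have "\<exists>R. \<forall>x. R < \<bar>x\<bar> \<longrightarrow> Some x \<in> ?g -` U" if "None \<in> ?g -` U"
  proof -
    obtain R where R: "\<And>x. R < \<bar>x\<bar> \<Longrightarrow> Some x \<in> U"
      using U \<open>None \<in> ?g -` U\<close> by (auto simp: openin_rhat_iff)
    have "Some x \<in> ?g -` U" if "(\<bar>R\<bar> + \<bar>b\<bar>) / \<bar>a\<bar> < \<bar>x\<bar>" for x
    proof -
      have "\<bar>R\<bar> + \<bar>b\<bar> < \<bar>a * x\<bar>"
        using that assms by (simp add: field_simps abs_mult)
      then have "R < \<bar>a * x + b\<bar>" by linarith
      then show ?thesis using R by simp
    qed
    then show ?thesis by blast
  qed
  ultimately show "openin rhat_top (?g -` U)"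
    by (simp add: openin_rhat_iff vimage_def)
qed

text \<open>Such a map is affine, or else a translation followed by inversion and an affine map;
  continuity is known for each factor.\<close>

lemma continuous_map_mobius:
  assumes "invertible M"
  shows "continuous_map rhat_top rhat_top (mobius M)"
proof (cases "M$2$1 = 0")
  case True
  then have nz: "M$1$1 \<noteq> 0" "M$2$2 \<noteq> 0"
    using assms by (auto simp: invertible_det_nz det_2)
  then have "mobius M = map_option (\<lambda>x. (M$1$1 / M$2$2) * x + M$1$2 / M$2$2)"
    using True by (intro ext) (auto simp: mobius_def field_simps split: option.splits)
  then show ?thesis
    using nz by (simp only:) (rule continuous_map_rhat_affine, simp)
next
  case False
  \<comment> \<open>This is the residue at the pole: the map is
    \<open>M$1$1 / M$2$1 + c / (x + M$2$2 / M$2$1)\<close>.\<close>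
  define c where "c = - det M / (M$2$1)\<^sup>2"
  have "c \<noteq> 0" using False assms by (simp add: c_def invertible_det_nz)
  have "mobius M p = (map_option (\<lambda>x. c * x + M$1$1 / M$2$1) \<circ> rhat_inverse \<circ>
      map_option (\<lambda>x. 1 * x + M$2$2 / M$2$1)) p" for p
  proof (cases p)
    case None
    then show ?thesis using False by (simp add: mobius_def rhat_inverse_def)
  next
    case (Some x)
    show ?thesis
    proof (cases "M$2$1 * x + M$2$2 = 0")
      case True
      then have "x + M$2$2 / M$2$1 = 0" using False by (simp add: field_simps)
      with True show ?thesis by (simp add: Some mobius_def rhat_inverse_def)
    next
      case nz: False
      have eq: "x + M$2$2 / M$2$1 = (M$2$1 * x + M$2$2) / M$2$1" using False by (simp add: field_simps)
      have "c * (M$2$1 / (M$2$1 * x + M$2$2)) + M$1$1 / M$2$1 =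
          (M$1$1 * x + M$1$2) / (M$2$1 * x + M$2$2)"
        using nz False by (simp add: c_def det_2 divide_simps power2_eq_square) (simp add: algebra_simps)
      with nz False show ?thesis
        by (simp add: Some mobius_def rhat_inverse_def eq)
    qed
  qed
  then have "mobius M = map_option (\<lambda>x. c * x + M$1$1 / M$2$1) \<circ> rhat_inverse \<circ>
      map_option (\<lambda>x. 1 * x + M$2$2 / M$2$1)" by blast
  moreover have "continuous_map rhat_top rhat_top (map_option (\<lambda>x. c * x + M$1$1 / M$2$1) \<circ> rhat_inverse \<circ>
      map_option (\<lambda>x. 1 * x + M$2$2 / M$2$1))"
    using \<open>c \<noteq> 0\<close>
    by (intro continuous_map_compose[OF continuous_map_rhat_affine[of 1]]
        continuous_map_compose[OF continuous_map_rhat_inverse continuous_map_rhat_affine]) simp_all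
  ultimately show ?thesis by (simp only:)
qed

section \<open>Transport of arcs by Moebius homeomorphisms\<close>

lemma mobius_inverse:
  assumes "invertible N"
  shows "mobius (matrix_inv N) (mobius N p) = p" "mobius N (mobius (matrix_inv N) p) = p"
    and "invertible (matrix_inv N)"
proof -
  show inv: "invertible (matrix_inv N)"
    using matrix_inv_mult[OF assms] by (auto simp: invertible_def)
  show "mobius (matrix_inv N) (mobius N p) = p" "mobius N (mobius (matrix_inv N) p) = p"
    using mobius_mult[OF assms, of "matrix_inv N"] mobius_mult[OF inv, of N]
    by (simp_all add: matrix_inv_mult[OF assms] mobius_mat_1 fun_eq_iff)
qed

lemma homeomorphic_map_mobius:
  assumes "invertible N"
  shows "homeomorphic_map rhat_top rhat_top (mobius N)"
proof -
  have "homeomorphic_maps rhat_top rhat_top (mobius N) (mobius (matrix_inv N))"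
    using mobius_inverse[OF assms] assms
    by (simp add: homeomorphic_maps_def continuous_map_mobius)
  then show ?thesis
    using homeomorphic_map_maps by blast
qed

lemma closed_arc_mobius:
  assumes "invertible N" "closed_arc J"
  shows "closed_arc (mobius N ` J)"
proof -
  note hom = homeomorphic_map_mobius[OF assms(1)]
  have "inj (mobius N)"
    using mobius_inverse(1)[OF assms(1)] by (metis injI)
  have J: "connectedin rhat_top J" "compactin rhat_top J"
    "subtopology rhat_top J homeomorphic_space top_of_set {0..1::real}"
    using assms(2) by (auto simp: closed_arc_def)
  have sub: "J \<subseteq> topspace rhat_top"
    unfolding topspace_rhat by simp
  have "homeomorphic_map (subtopology rhat_top J) (subtopology rhat_top (mobius N ` J)) (mobius N)"
    by (rule homeomorphic_map_subtopologies[OF hom]) (simp only: topspace_rhat Int_UNIV_left)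
  then have "subtopology rhat_top (mobius N ` J) homeomorphic_space top_of_set {0..1::real}"
    using J(3) homeomorphic_map_imp_homeomorphic_space homeomorphic_space_sym homeomorphic_space_trans
    by blast
  then show ?thesis
    using J homeomorphic_map_connectedness[OF hom sub] homeomorphic_map_compactness[OF hom sub]
    by (simp add: closed_arc_def)
qed

lemma interior_of_mobius:
  assumes "invertible N"
  shows "rhat_top interior_of (mobius N ` J) = mobius N ` (rhat_top interior_of J)"
  by (rule homeomorphic_map_interior_of[OF homeomorphic_map_mobius[OF assms]])
     (simp only: topspace_rhat subset_UNIV)

section \<open>Subsets of the real chart\<close>

lemma homeomorphic_map_Some:
  "homeomorphic_map euclideanreal (subtopology rhat_top (range Some)) Some"
  using embedding_map_Some[of euclideanreal] by (simp add: embedding_map_def)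

lemma connectedin_image_Some: "connectedin rhat_top (Some ` S) \<longleftrightarrow> connected S"
  using homeomorphic_map_connectedness[OF homeomorphic_map_Some, of S]
  by (simp add: connectedin_subtopology image_mono)

lemma compactin_image_Some: "compactin rhat_top (Some ` S) \<longleftrightarrow> compact S"
  using homeomorphic_map_compactness[OF homeomorphic_map_Some, of S]
  by (simp add: compactin_subtopology image_mono)

lemma homeomorphic_space_image_Some:
  "subtopology rhat_top (Some ` S) homeomorphic_space top_of_set S"
proof -
  have "homeomorphic_map (top_of_set S) (subtopology (subtopology rhat_top (range Some)) (Some ` S)) Some"
    by (rule homeomorphic_map_subtopologies[OF homeomorphic_map_Some]) auto
  moreover have "range Some \<inter> Some ` S = Some ` S" by auto
  ultimately show ?thesis
    using homeomorphic_map_imp_homeomorphic_space homeomorphic_space_sym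
    by (metis subtopology_subtopology)
qed

lemma closed_arc_interval: "closed_arc (Some ` {-1..1})"
proof -
  have "top_of_set {-1..1::real} homeomorphic_space top_of_set {0..1::real}"
    unfolding homeomorphic_space_def homeomorphic_maps_def
    by (rule exI[of _ "\<lambda>x. (x + 1) / 2"], rule exI[of _ "\<lambda>y. 2 * y - 1"])
       (auto simp: continuous_map_in_subtopology field_simps intro!: continuous_intros)
  with homeomorphic_space_image_Some[of "{-1..1}"]
  have "subtopology rhat_top (Some ` {-1..1}) homeomorphic_space top_of_set {0..1::real}"
    by (rule homeomorphic_space_trans)
  then show ?thesis
    unfolding closed_arc_def connectedin_image_Some compactin_image_Some by simp
qed

lemma interior_of_interval: "rhat_top interior_of (Some ` {-1..1}) = Some ` {-1<..<1}"
proof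
  define U where "U = rhat_top interior_of (Some ` {-1..1})"
  have "openin rhat_top U" "U \<subseteq> Some ` {-1..1}"
    by (simp_all only: U_def openin_interior_of interior_of_subset)
  then have "{x. Some x \<in> U} \<subseteq> interior {-1..1}"
    by (intro interior_maximal) (auto simp: openin_rhat_iff)
  then show "U \<subseteq> Some ` {-1<..<1}"
    using \<open>U \<subseteq> Some ` {-1..1}\<close> by (auto simp: subset_eq)
next
  show "Some ` {-1<..<1} \<subseteq> rhat_top interior_of (Some ` {-1..1})"
    by (rule interior_of_maximal) auto
qed

section \<open>Normal form of closed arcs\<close>

lemma mobius_transitive: obtains R where "invertible R" "mobius R None = p"
proof (cases p)
  case None
  show ?thesis by (rule that[of "mat 1"]) (simp_all add: None mobius_mat_1 invertible_det_nz)
next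
  case (Some x)
  show ?thesis
    by (rule that[of "vector [vector [x, 1], vector [1, 0]]"])
       (simp_all add: Some mobius_def invertible_det_nz det_2)
qed

text \<open>A Moebius map sending infinity to \<open>p\<close> carries the real line onto the
  complement of \<open>p\<close>.\<close>

lemma connected_punctured_rhat: "connectedin rhat_top (UNIV - {p})"
proof -
  obtain R where R: "invertible R" "mobius R None = p" by (rule mobius_transitive)
  have "q \<in> mobius R ` range Some" if "q \<noteq> p" for q
  proof -
    have "mobius (matrix_inv R) q \<noteq> None"
      using mobius_inverse(2)[OF R(1), of q] R(2) that by metis
    then show ?thesis
      using mobius_inverse(2)[OF R(1), of q] by (metis imageI not_None_eq rangeI)
  qed
  moreover have "p \<notin> mobius R ` range Some"
    using mobius_inverse(1)[OF R(1)] R(2) by (metis imageE option.distinct(1))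
  ultimately have "UNIV - {p} = mobius R ` range Some" by auto
  moreover have "connectedin rhat_top (mobius R ` range Some)"
    using continuous_map_mobius[OF R(1)]
    by (rule connectedin_continuous_map_image) (simp add: connectedin_image_Some)
  ultimately show ?thesis by simp
qed

text \<open>Removing the point that corresponds to \<open>1/2\<close> disconnects the unit interval
  but not the projective line. Hence a closed arc always misses a point.\<close>

lemma not_closed_arc_UNIV: "\<not> closed_arc UNIV"
proof
  assume "closed_arc UNIV"
  then obtain h where h: "homeomorphic_map rhat_top (top_of_set {0..1::real}) h"
    by (auto simp: closed_arc_def homeomorphic_space)
  have surj: "h ` UNIV = {0..1}"
    using homeomorphic_imp_surjective_map[OF h] unfolding topspace_rhat by simp
  have inj: "inj h"
    using homeomorphic_imp_injective_map[OF h] unfolding topspace_rhat .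
  have "1/2 \<in> h ` UNIV" unfolding surj by simp
  then obtain p where p: "h p = 1/2" by auto
  have "connectedin (top_of_set {0..1}) (h ` (UNIV - {p}))"
    using homeomorphic_imp_continuous_map[OF h] connected_punctured_rhat
    by (rule connectedin_continuous_map_image)
  moreover have "h ` (UNIV - {p}) = {0..1} - {1/2}"
    using image_set_diff[OF inj, of UNIV "{p}"] surj p by simp
  ultimately have "connected ({0..1} - {1/2::real})"
    by (simp add: connectedin_subtopology)
  then have "(1/2::real) \<in> {0..1} - {1/2}"
    by (rule connectedD_interval[of _ 0 1]) auto
  then show False by simp
qed

text \<open>Sending a missed point to infinity turns the arc into a compact interval of the real
  line, which an affine map compares with \<open>{-1..1}\<close>.\<close>

lemma closed_arc_imp_mobius_interval:
  assumes "closed_arc J"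
  obtains N where "invertible N" "J = mobius N ` Some ` {-1..1}"
proof -
  obtain p where p: "p \<notin> J"
    using assms not_closed_arc_UNIV by (metis UNIV_eq_I)
  obtain R where R: "invertible R" "mobius R None = p" by (rule mobius_transitive)
  note R_inv = mobius_inverse[OF R(1)]
  define K where "K = mobius (matrix_inv R) ` J"
  have J: "J = mobius R ` K"
    using R_inv(2) by (simp add: K_def image_image)
  have "None \<notin> K"
    using p R J by blast
  define S where "S = {x. Some x \<in> K}"
  have K: "K = Some ` S"
  proof (rule set_eqI)
    fix q show "q \<in> K \<longleftrightarrow> q \<in> Some ` S"
      using \<open>None \<notin> K\<close> by (cases q) (auto simp: S_def)
  qed
  have "closed_arc K"
    unfolding K_def using R_inv(3) assms by (rule closed_arc_mobius)
  then have "connected S" "compact S" and hom: "subtopology rhat_top K homeomorphic_space top_of_set {0..1::real}"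
    by (simp_all add: closed_arc_def K connectedin_image_Some compactin_image_Some)
  then obtain a b where ab: "S = {a..b}"
    using connected_compact_interval_1[of S] by (auto simp: box_real)
  \<comment> \<open>Otherwise the arc would have at most one point and could not be mapped onto the
    unit interval.\<close>
  have "a < b"
  proof (rule ccontr)
    assume "\<not> a < b"
    then have "finite K" by (cases "a = b") (auto simp: K ab)
    obtain h where "homeomorphic_map (subtopology rhat_top K) (top_of_set {0..1::real}) h"
      using hom by (auto simp: homeomorphic_space)
    then have "h ` K = {0..1}"
      by (auto dest!: homeomorphic_imp_surjective_map simp del: topspace_Alexandroff_compactification simp: topspace_rhat)
    with finite_imageI[OF \<open>finite K\<close>, of h] show False
      by (simp add: infinite_Icc)
  qed
  define L :: "real^2^2" where "L = vector [vector [(b - a) / 2, (a + b) / 2], vector [0, 1]]"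
  have L: "invertible L"
    using \<open>a < b\<close> by (simp add: L_def invertible_det_nz det_2)
  have "mobius L ` Some ` {-1..1} = Some ` (\<lambda>x. (b - a) / 2 * x + (a + b) / 2) ` {-1..1}"
    by (simp add: image_image mobius_def L_def)
  also have "(\<lambda>x. (b - a) / 2 * x + (a + b) / 2) ` {-1..1} = {a..b}"
    using \<open>a < b\<close> by (subst image_affinity_atLeastAtMost) (auto simp: field_simps)
  finally have "J = mobius R ` mobius L ` Some ` {-1..1}"
    by (simp only: J K ab)
  then have "J = mobius (R ** L) ` Some ` {-1..1}"
    by (simp only: mobius_mult[OF L] image_comp o_assoc)
  moreover have "invertible (R ** L)"
    using R(1) L by (rule invertible_mult)
  ultimately show ?thesis by (rule that[rotated])
qed

section \<open>The quadrant seen on the projective line\<close>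

lemma proj_cay_interval:
  assumes "v \<noteq> 0"
  shows "proj (cay v) \<in> Some ` {-1..1} \<longleftrightarrow> 0 \<le> v$1 * v$2"
    and "proj (cay v) \<in> Some ` {-1<..<1} \<longleftrightarrow> 0 < v$1 * v$2"
proof -
  let ?x = "v$1" and ?y = "v$2"
  have "(proj (cay v) \<in> Some ` {-1..1} \<longleftrightarrow> 0 \<le> ?x * ?y) \<and>
    (proj (cay v) \<in> Some ` {-1<..<1} \<longleftrightarrow> 0 < ?x * ?y)"
  proof (cases "?x + ?y = 0")
    case True
    then have "?y = - ?x" by simp
    moreover have "?x \<noteq> 0"
      using assms True by (auto simp: vec_2_eq_iff)
    ultimately have "?x * ?y < 0" by (simp add: not_sum_squares_lt_zero order_less_le)
    with True show ?thesis by (auto simp: proj_def cay_def)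
  next
    case False
    then have pos: "0 < (?x + ?y)\<^sup>2" by simp
    \<comment> \<open>For the point \<open>z\<close> of \<open>cay v\<close> this identity makes the
      sign of \<open>1 - z^2\<close> that of the product of the coordinates of
      \<open>v\<close>.\<close>
    have *: "1 - ((?x - ?y) / (?x + ?y))\<^sup>2 = 4 * (?x * ?y) / (?x + ?y)\<^sup>2"
      using False by (simp add: power_divide field_simps) (simp add: power2_eq_square algebra_simps)
    have sq: "Some z \<in> Some ` {-1..1} \<longleftrightarrow> 0 \<le> 1 - z\<^sup>2" "Some z \<in> Some ` {-1<..<1} \<longleftrightarrow> 0 < 1 - z\<^sup>2" for z :: real
      using abs_square_le_1[of z] abs_square_less_1[of z]
      by (auto simp: abs_le_iff abs_less_iff inj_image_mem_iff)
    have "0 \<le> 4 * P / (?x + ?y)\<^sup>2 \<longleftrightarrow> 0 \<le> P" "0 < 4 * P / (?x + ?y)\<^sup>2 \<longleftrightarrow> 0 < P" for P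
      using pos by (simp_all add: zero_le_divide_iff zero_less_divide_iff)
    moreover have "proj (cay v) = Some ((?x - ?y) / (?x + ?y))"
      using False by (simp add: proj_def cay_def)
    ultimately show ?thesis by (simp only: sq *)
  qed
  then show "proj (cay v) \<in> Some ` {-1..1} \<longleftrightarrow> 0 \<le> ?x * ?y"
    "proj (cay v) \<in> Some ` {-1<..<1} \<longleftrightarrow> 0 < ?x * ?y" by blast+
qed

lemma mobius_Fmat_strictly_invariant:
  assumes "invertible M"
  shows "mobius (Fmat M) ` Some ` {-1..1} \<subseteq> Some ` {-1<..<1} \<longleftrightarrow> pos_mat M \<or> pos_mat (- M)"
    (is "?L \<longleftrightarrow> ?R")
proof
  assume ?L
  have prod: "0 < (M *v v)$1 * (M *v v)$2" if "v \<noteq> 0" "0 \<le> v$1 * v$2" for v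
  proof -
    have "mobius (Fmat M) (proj (cay v)) \<in> Some ` {-1<..<1}"
      using \<open>?L\<close> proj_cay_interval(1)[OF that(1)] that(2) by blast
    then have "proj (cay (M *v v)) \<in> Some ` {-1<..<1}"
      using that(1) by (simp only: mobius_proj cay_simps Fmat_mult_cay not_False_eq_True)
    then show ?thesis
      using proj_cay_interval(2) mult_vec_nonzero[OF assms that(1)] by blast
  qed
  \<comment> \<open>The images of the two edges lie in the open double quadrant, so each column of
    \<open>M\<close> has entries of one strict sign.\<close>
  have c1: "0 < M$1$1 * M$2$1"
    using prod[of "vector [1, 0]"] by (simp add: vec_2_eq_iff mult_vec_2)
  have c2: "0 < M$1$2 * M$2$2"
    using prod[of "vector [0, 1]"] by (simp add: vec_2_eq_iff mult_vec_2)
  \<comment> \<open>If the columns had opposite signs, the vector \<open>(- M$1$2, M$1$1)\<close>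
    would lie in the closed double quadrant, although \<open>M\<close> sends it to a vector with
    first coordinate 0.\<close>
  have "0 < M$1$1 * M$1$2"
  proof (rule ccontr)
    assume "\<not> 0 < M$1$1 * M$1$2"
    then have "0 \<le> (- M$1$2) * M$1$1" by (simp add: mult.commute)
    moreover have "M$1$1 \<noteq> 0" using c1 by auto
    ultimately show False
      using prod[of "vector [- M$1$2, M$1$1]"] by (simp add: vec_2_eq_iff mult_vec_2)
  qed
  with c1 c2 show ?R
    by (auto simp: pos_mat_def forall_2 zero_less_mult_iff)
next
  assume ?R
  have prod: "0 < (N *v v)$1 * (N *v v)$2" if N: "pos_mat N" and v: "v \<noteq> 0" "0 \<le> v$1 * v$2" for N v
  proof -
    have pos: "0 < N$i$j" for i j
      using N by (simp add: pos_mat_def)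
    \<comment> \<open>This is the expanded product of the two coordinates of the image: the square
      terms are positive in sum and the mixed term is nonnegative.\<close>
    have "0 < a * v$1 * (c * v$1) + b * v$2 * (d * v$2) + (a * d + b * c) * (v$1 * v$2)"
      if "0 < a" "0 < b" "0 < c" "0 < d" for a b c d :: real
    proof -
      have "0 < a * c * (v$1)\<^sup>2 + b * d * (v$2)\<^sup>2"
        using v(1) that by (cases "v$1 = 0") (auto simp: vec_2_eq_iff intro: add_pos_nonneg)
      moreover have "0 \<le> (a * d + b * c) * (v$1 * v$2)"
        using v(2) that by simp
      ultimately show ?thesis by (simp add: power2_eq_square algebra_simps)
    qed
    from this[of "N$1$1" "N$1$2" "N$2$1" "N$2$2"] pos show ?thesis
      by (simp add: mult_vec_2 algebra_simps)
  qed
  have *: "0 < (M *v v)$1 * (M *v v)$2" if "v \<noteq> 0" "0 \<le> v$1 * v$2" for v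
    using \<open>?R\<close>
  proof
    assume "pos_mat (- M)"
    from prod[OF this that] show ?thesis
      by (simp add: mult_vec_2 algebra_simps)
  qed (rule prod[OF _ that])
  show ?L
  proof (rule image_subsetI)
    fix p :: rhat assume "p \<in> Some ` {-1..1}"
    obtain u where u: "u \<noteq> 0" "p = proj u" by (rule proj_cases)
    obtain v where v: "u = cay v" by (rule cay_surj)
    have "v \<noteq> 0" using u v by (simp add: cay_simps)
    then have "0 \<le> v$1 * v$2"
      using \<open>p \<in> Some ` {-1..1}\<close> proj_cay_interval(1) u v by metis
    then have "proj (cay (M *v v)) \<in> Some ` {-1<..<1}"
      using * \<open>v \<noteq> 0\<close> proj_cay_interval(2) mult_vec_nonzero[OF assms] by blast
    then show "mobius (Fmat M) p \<in> Some ` {-1<..<1}"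
      using \<open>v \<noteq> 0\<close> by (simp only: u v mobius_proj cay_simps Fmat_mult_cay not_False_eq_True)
  qed
qed

text \<open>Every closed arc is the image of \<open>B\<close> under some
  \<open>mobius (Fmat Q)\<close>. Pulled back by this map, invariance concerns \<open>B\<close> and
  \<open>matrix_inv Q ** A i ** Q\<close>, so \<open>P\<close> corresponds to
  \<open>matrix_inv Q\<close>.\<close>

lemma arc_iff_conjugate_positive:
  fixes A :: "'i \<Rightarrow> real^2^2"
  assumes inv: "\<forall>i\<in>I. invertible (A i)" and nonneg: "\<forall>i\<in>I. nonneg_mat (A i)"
  shows "common_strictly_invariant_arc I (\<lambda>i. mobius (Fmat (A i))) \<longleftrightarrow>
    (\<exists>P :: real^2^2. invertible P \<and> (\<forall>i\<in>I. pos_mat (P ** A i ** matrix_inv P)))"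
proof -
  define B where "B = (Some ` {-1..1} :: rhat set)"
  define B' where "B' = (Some ` {-1<..<1} :: rhat set)"
  have key: "mobius (Fmat (A i)) ` (mobius (Fmat Q) ` B) \<subseteq> mobius (Fmat Q) ` B' \<longleftrightarrow>
      pos_mat (matrix_inv Q ** A i ** Q)" if i: "i \<in> I" and Q: "invertible Q" for i Q
  proof -
    define M where "M = matrix_inv Q ** A i ** Q"
    have QM: "Q ** M = A i ** Q"
      by (simp add: M_def matrix_mul_assoc matrix_inv_mult[OF Q])
    have "invertible M"
      using inv i Q mobius_inverse(3)[OF Q] by (simp add: M_def invertible_mult)
    \<comment> \<open>Similarity preserves the trace, which is nonnegative for \<open>A i\<close>;
      this rules out the negative sign in the invariance criterion.\<close>
    have "trace M = trace (A i)"
      unfolding M_def by (metis trace_mul_sym matrix_mul_assoc matrix_inv_mult(1)[OF Q] matrix_mul_lid)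
    then have "0 \<le> M$1$1 + M$2$2"
      using nonneg i by (simp add: trace_def sum_2 nonneg_mat_def)
    then have neg: "\<not> pos_mat (- M)"
      by (auto simp: pos_mat_def forall_2)
    have "mobius (Fmat (A i)) \<circ> mobius (Fmat Q) = mobius (Fmat Q) \<circ> mobius (Fmat M)"
      using Q \<open>invertible M\<close> by (simp add: QM flip: mobius_mult Fmat_mult add: invertible_Fmat)
    then have "mobius (Fmat (A i)) ` (mobius (Fmat Q) ` B) = mobius (Fmat Q) ` (mobius (Fmat M) ` B)"
      by (metis image_comp)
    moreover have "inj (mobius (Fmat Q))"
      using mobius_inverse(1)[of "Fmat Q"] Q by (metis injI invertible_Fmat)
    ultimately have "mobius (Fmat (A i)) ` (mobius (Fmat Q) ` B) \<subseteq> mobius (Fmat Q) ` B' \<longleftrightarrow>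
        mobius (Fmat M) ` B \<subseteq> B'"
      by (simp add: inj_image_subset_iff)
    then show ?thesis
      using mobius_Fmat_strictly_invariant[OF \<open>invertible M\<close>] neg unfolding B_def B'_def M_def by simp
  qed
  have "common_strictly_invariant_arc I (\<lambda>i. mobius (Fmat (A i))) \<longleftrightarrow>
      (\<exists>Q. invertible Q \<and> (\<forall>i\<in>I. mobius (Fmat (A i)) ` (mobius (Fmat Q) ` B) \<subseteq> mobius (Fmat Q) ` B'))"
    (is "?L \<longleftrightarrow> ?R")
  proof
    assume ?L
    then obtain J where J: "closed_arc J" "\<forall>i\<in>I. mobius (Fmat (A i)) ` J \<subseteq> rhat_top interior_of J"
      unfolding common_strictly_invariant_arc_def by blast
    obtain N where N: "invertible N" "J = mobius N ` B"
      unfolding B_def using J(1) by (rule closed_arc_imp_mobius_interval)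
    obtain Q where Q: "N = Fmat Q" by (rule Fmat_surj)
    have "rhat_top interior_of J = mobius N ` B'"
      unfolding N(2) interior_of_mobius[OF N(1)] B_def B'_def interior_of_interval ..
    with J(2) N Q show ?R
      by (metis invertible_Fmat)
  next
    assume ?R
    then obtain Q where Q: "invertible Q"
      "\<forall>i\<in>I. mobius (Fmat (A i)) ` (mobius (Fmat Q) ` B) \<subseteq> mobius (Fmat Q) ` B'" by blast
    have FQ: "invertible (Fmat Q)" using Q(1) by (simp add: invertible_Fmat)
    have "rhat_top interior_of (mobius (Fmat Q) ` B) = mobius (Fmat Q) ` B'"
      unfolding interior_of_mobius[OF FQ] B_def B'_def interior_of_interval ..
    moreover have "closed_arc (mobius (Fmat Q) ` B)"
      unfolding B_def using FQ closed_arc_interval by (rule closed_arc_mobius)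
    ultimately show ?L
      unfolding common_strictly_invariant_arc_def using Q(2) by metis
  qed
  also have "\<dots> \<longleftrightarrow> (\<exists>Q. invertible Q \<and> (\<forall>i\<in>I. pos_mat (matrix_inv Q ** A i ** Q)))"
    using key by (intro ex_cong1 conj_cong ball_cong refl)
  also have "\<dots> \<longleftrightarrow> (\<exists>P :: real^2^2. invertible P \<and> (\<forall>i\<in>I. pos_mat (P ** A i ** matrix_inv P)))"
  proof -
    have "matrix_inv (matrix_inv Q) = Q" "invertible (matrix_inv Q)" if "invertible Q" for Q :: "real^2^2"
      using matrix_inv_mult[OF that] mobius_inverse(3)[OF that] matrix_inv_eqI by blast+
    note inv_inv = this
    show ?thesis
    proof
      assume "\<exists>Q. invertible Q \<and> (\<forall>i\<in>I. pos_mat (matrix_inv Q ** A i ** Q))"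
      then obtain Q where "invertible Q" "\<forall>i\<in>I. pos_mat (matrix_inv Q ** A i ** Q)" by blast
      then show "\<exists>P. invertible P \<and> (\<forall>i\<in>I. pos_mat (P ** A i ** matrix_inv P))"
        by (intro exI[of _ "matrix_inv Q"]) (simp add: inv_inv)
    next
      assume "\<exists>P. invertible P \<and> (\<forall>i\<in>I. pos_mat (P ** A i ** matrix_inv P))"
      then obtain P where "invertible P" "\<forall>i\<in>I. pos_mat (P ** A i ** matrix_inv P)" by blast
      then show "\<exists>Q. invertible Q \<and> (\<forall>i\<in>I. pos_mat (matrix_inv Q ** A i ** Q))"
        by (intro exI[of _ "matrix_inv P"]) (simp add: inv_inv)
    qed
  qed
  finally show ?thesis .
qed

section \<open>Assembly: the positive conjugates link arcs and connections\<close>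

theorem theorem1p4:
  fixes I :: "'i set" and A :: "'i \<Rightarrow> real^2^2" and f :: "'i \<Rightarrow> rhat \<Rightarrow> rhat"
  assumes "finite I"
    and "\<And>i. i \<in> I \<Longrightarrow> invertible (A i)"
    and "\<And>i. i \<in> I \<Longrightarrow> nonneg_mat (A i)"
    and "\<And>i. i \<in> I \<Longrightarrow> f i = mobius (Fmat (A i))"
  shows "(\<not> gen_heteroclinic_connection 2 I A \<longleftrightarrow> common_strictly_invariant_arc I f) \<and>
         (common_strictly_invariant_arc I f \<longleftrightarrow>
           (\<exists>P :: real^2^2. invertible P \<and>
              (\<forall>i\<in>I. pos_mat (P ** A i ** matrix_inv P))))"
proof -
  have inv: "\<forall>i\<in>I. invertible (A i)" using assms(2) by blast
  have "common_strictly_invariant_arc I f \<longleftrightarrow> common_strictly_invariant_arc I (\<lambda>i. mobius (Fmat (A i)))"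
    unfolding common_strictly_invariant_arc_def using assms(4) by simp
  also have "\<dots> \<longleftrightarrow> (\<exists>P :: real^2^2. invertible P \<and> (\<forall>i\<in>I. pos_mat (P ** A i ** matrix_inv P)))"
    (is "_ \<longleftrightarrow> ?P")
    using inv assms(3) by (intro arc_iff_conjugate_positive) blast+
  finally have arc: "common_strictly_invariant_arc I f \<longleftrightarrow> ?P" .
  have "\<not> gen_heteroclinic_connection 2 I A" if ?P
    using that no_connection_if_conjugate_positive[OF inv] by blast
  moreover have ?P if "\<not> gen_heteroclinic_connection 2 I A"
  proof -
    have nonneg: "\<forall>i\<in>I. nonneg_mat (A i)" using assms(3) by blast
    show ?P
      \<comment> \<open>The directions \<alpha> and \<beta> obtained here are exactly the input of
        the perturbation of the quadrant.\<close>
      by (rule ex_cone_directions[OF assms(1) inv nonneg that])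
        (rule conjugate_positive_if_directions[OF assms(1)]; (rule assms(3))?; assumption)
  qed
  ultimately show ?thesis using arc by blast
qed

end
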